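(* Let $\mathcal{G}=\langle \mathit{Init},\mathit{Safe},\mathit{Reach},\mathit{Goal}\rangle$ be a reachability game. If the procedure $\operatorname{Reach}(\mathcal{G})$ (described in the context) returns a triple $(R,\mathfrak{S}_{\mathrm{REACH}},\mathfrak{S}_{\mathrm{SAFE}})$, then: $R$ characterizes the set of initial states that are winning for REACH in $\mathcal{G}$ (i.e., a state $s$ satisfying $\mathit{Init}$ satisfies $R$ iff REACH wins from $s$ in $\mathcal{G}$); $\mathfrak{S}_{\mathrm{REACH}}$ is a winning symbolic reachability strategy in every state satisfying $R$; and $\mathfrak{S}_{\mathrm{SAFE}}$ is a winning symbolic safety strategy in every state satisfying $\mathit{Init}\land\neg R$.
   Context: Setting. Fix a logic $\mathcal{L}$ and a finite set of variables $\mathcal{V}$ with domains, primed copies $\mathcal{V}'$, and a Boolean variable $\mathbf{r}\in\mathcal{V}$; $\varphi[\mathcal{V}/\mathcal{V}']$ primes all variables, $\varphi[\mathcal{V}'/\mathcal{V}]$ unprimes them. A state is a valuation of $\mathcal{V}$ respecting domains; $S$ the states, $S_{\mathrm{REACH}}=\{s:s(\mathbf{r})=\mathrm{true}\}$, $S_{\mathrm{SAFE}}=S\setminus S_{\mathrm{REACH}}$; $\varphi(s)$, $\tau(s,s')$ denote evaluation of state predicates (formulas over $\mathcal{V}$) and transition predicates (over $\mathcal{V}\cup\mathcal{V}'$), $\tau(s)$ substitutes only unprimed variables. A reachability game $\langle \mathit{Init},\mathit{Safe},\mathit{Reach},\mathit{Goal}\rangle$ has state predicates $\mathit{Init},\mathit{Goal}$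 and transition predicates $\mathit{Safe},\mathit{Reach}$ with $\mathit{Safe}\Rightarrow\neg\mathbf{r}$, $\mathit{Reach}\Rightarrow\mathbf{r}$ valid. A trap state is $s$ with $(\mathit{Safe}\lor\mathit{Reach})(s)$ unsatisfiable. A play from $s_0$ is a finite or infinite sequence $s_0s_1\ldots$ with $\mathit{Safe}(s_i,s_{i+1})$ or $\mathit{Reach}(s_i,s_{i+1})$ for consecutive pairs, ending in a trap state if finite. REACH wins a play if some state on it satisfies $\mathit{Goal}$; else SAFE wins. A reachability strategy is $\sigma_R:S^*S_{\mathrm{REACH}}\to S$ with $\mathit{Reach}(s,\sigma_R(ws))$ whenever $s$ is not a trap; safety strategies analogously; REACH wins from $s$ if some reachability strategy wins every consistent play from $s$. A symbolic strategy is a transition predicate $\mathfrak{S}$ with $\mathfrak{S}\Rightarrow(\mathit{Safe}\lor\mathit{Reach})$ valid. A play prefix is a finite prefix $s_0\ldots s_n$ of a play with $\neg\mathit{Goal}(s_j)$ for all $j\le n$ and $s_n$ not a trap. A prefix conforms to a symbolic reachability (safety) strategy $\mathfrak{S}$ if $\mathfrak{S}(s_j,s_{j+1})$ for all $j<n$ with $s_j\in S_{\mathrm{REACH}}$ ($s_j\in S_{\mathrm{SAFE}}$); a play conforms if all its play prefixes do. $\mathfrak{S}$ is winning for REACH (SAFE) in $s$ if every play from $s$ conforming to $\mathfrak{S}$ is won by REACH (SAFE) and every conforming play prefix from $s$ ending in $s_n\in S_{\mathrm{REACH}}$ ($S_{\mathrm{SAFE}}$) has $(\mathfrak{S}\land\mathit{Reach})(s_n)$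 (resp. $(\mathfrak{S}\land\mathit{Safe})(s_n)$) satisfiable. Operators. $\operatorname{Pre}(T)=\exists\mathcal{V}'.T$, $\operatorname{Post}(T)=\exists\mathcal{V}.T$, $\operatorname{Instantiate}(\varphi,\mathcal{G})=(\mathit{Safe}\lor\mathit{Reach})\land\neg\varphi\land\varphi[\mathcal{V}/\mathcal{V}']$, $\operatorname{Enf}(T,\mathcal{G})=(\mathit{Safe}\lor\mathit{Reach})\land T\land\neg\exists\mathcal{V}'.(\mathit{Safe}\land\neg T)$. $\operatorname{Interpolate}$ is any fixed function that, given formulas $\alpha,\beta$ with $\alpha\land\beta$ unsatisfiable, returns a formula $\theta$ with $\beta\Rightarrow\theta$ valid, $\theta\land\alpha$ unsatisfiable, and only variables shared by $\alpha,\beta$. $\operatorname{combine}(A,F,B):=(\operatorname{Pre}(B)\Rightarrow B)\land((\neg\operatorname{Pre}(B)\land\operatorname{Pre}(F))\Rightarrow F)\land((\neg\operatorname{Pre}(B)\land\neg\operatorname{Pre}(F))\Rightarrow A)\land(\operatorname{Pre}(B)\lor\operatorname{Pre}(F)\lor\operatorname{Pre}(A))$. Procedure $\operatorname{Reach}(\mathcal{G})$ for $\mathcal{G}=\langle \mathit{Init},\mathit{Safe},\mathit{Reach},\mathit{Goal}\rangle$: (1) $R:=\mathit{Init}\land\mathit{Goal}$; $I:=\mathit{Init}\land\neg\mathit{Goal}$. (2) If $I$ is unsatisfiable, return $(R,\mathrm{false},\mathrm{false})$. (3) $\varphi:=\operatorname{Interpolate}(I,\mathit{Goal})$; $C:=\operatorname{Instantiate}(\varphi,\mathcal{G})$.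 (4) If $\operatorname{Enf}(C,\mathcal{G})$ is unsatisfiable, return $(R,\mathrm{false},\mathit{Safe}\land\neg C)$. (5) $\mathcal{G}_{post}:=\langle \operatorname{Post}(C)[\mathcal{V}'/\mathcal{V}],\mathit{Safe}\land\varphi,\mathit{Reach}\land\varphi,\mathit{Goal}\rangle$; $(R_{post},\mathfrak{S}^{post}_{\mathrm{REACH}},\mathfrak{S}^{post}_{\mathrm{SAFE}}):=\operatorname{Reach}(\mathcal{G}_{post})$. (6) $F:=C\land R_{post}[\mathcal{V}/\mathcal{V}']$. (7) If $\operatorname{Enf}(F,\mathcal{G})$ is unsatisfiable, return $(R,\mathrm{false},\mathit{Safe}\land\neg F\land(\varphi\Rightarrow\mathfrak{S}^{post}_{\mathrm{SAFE}}))$. (8) If $(\mathit{Reach}\lor\mathit{Safe})\land\varphi\land\neg\varphi[\mathcal{V}/\mathcal{V}']\land\neg\mathit{Goal}$ is satisfiable, set $F:=F\lor\mathit{Goal}[\mathcal{V}/\mathcal{V}']$ and $\varphi:=\mathrm{false}$. (9) $\mathcal{G}_{pre}:=\langle I,\mathit{Safe}\land\neg F,\mathit{Reach}\land\neg F,\operatorname{Pre}(\operatorname{Enf}(F,\mathcal{G}))\rangle$; $(R_{pre},\mathfrak{S}^{pre}_{\mathrm{REACH}},\mathfrak{S}^{pre}_{\mathrm{SAFE}}):=\operatorname{Reach}(\mathcal{G}_{pre})$. (10) Return $(R\lor R_{pre},\ \operatorname{combine}(\mathfrak{S}^{pre}_{\mathrm{REACH}},F,\mathfrak{S}^{post}_{\mathrm{REACH}}),\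 (\neg\varphi\Rightarrow\mathfrak{S}^{pre}_{\mathrm{SAFE}})\land(\varphi\Rightarrow\mathfrak{S}^{post}_{\mathrm{SAFE}}))$.
   Formalization: Two corrections, as the literal claim is false: a play conforms if every move out of its play prefixes does (including moves into Goal or trap states), and step (8) sets F := F ∨ ((Safe ∨ Reach) ∧ Goal[V/V']) instead of F ∨ Goal[V/V']. *)

theory Defs
  imports "HOL-Library.Extended_Nat"
begin

section \<open>The underlying logic\<close>

datatype 'v pvar = Cur (base: 'v) | Nxt (base: 'v)

text \<open>
  The logic is abstract: \<open>'f\<close> is the type of its formulas with free variables among the
  finitely many program variables \<open>'v\<close> and their primed copies, and \<open>'d\<close> is a universe
  containing all domains.  \<open>exs X \<phi>\<close> quantifies existentially over all variables in \<open>X\<close>;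
  \<open>prime \<phi>\<close> is \<open>\<phi>[V/V']\<close> and \<open>unprime \<phi>\<close> is \<open>\<phi>[V'/V]\<close>.
\<close>

record ('f, 'v, 'd) logic_sig =
  domain :: "'v \<Rightarrow> 'd set"
  boolval :: "bool \<Rightarrow> 'd"
  rvar :: 'v
  fv :: "'f \<Rightarrow> 'v pvar set"
  models :: "('v pvar \<Rightarrow> 'd) \<Rightarrow> 'f \<Rightarrow> bool"
  rform :: 'f ("\<^bold>r\<index>")
  fls :: 'f ("\<^bold>\<bottom>\<index>")
  fneg :: "'f \<Rightarrow> 'f" ("\<^bold>\<not>\<index> _" [75] 75)
  fconj :: "'f \<Rightarrow> 'f \<Rightarrow> 'f" (infixr "\<^bold>\<and>\<index>" 70)
  fdisj :: "'f \<Rightarrow> 'f \<Rightarrow> 'f" (infixr "\<^bold>\<or>\<index>" 65)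
  fimp :: "'f \<Rightarrow> 'f \<Rightarrow> 'f" (infixr "\<^bold>\<longrightarrow>\<index>" 60)
  exs :: "'v pvar set \<Rightarrow> 'f \<Rightarrow> 'f"
  prime :: "'f \<Rightarrow> 'f"
  unprime :: "'f \<Rightarrow> 'f"

definition vals :: "('f, 'v, 'd) logic_sig \<Rightarrow> ('v pvar \<Rightarrow> 'd) set" where
  "vals L = {\<nu>. \<forall>x. \<nu> x \<in> domain L (base x)}"

text \<open>
  The conditions on free variables are inclusions, so that a logic in which \<open>exs X \<phi>\<close> is
  realised by quantifier elimination is covered as well.
\<close>

locale reach_logic =
  fixes L :: "('f, 'v::finite, 'd) logic_sig" (structure)
  assumes dom_nonempty: "domain L v \<noteq> {}"
    and boolval_inj: "boolval L True \<noteq> boolval L False"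
    and dom_rvar: "domain L (rvar L) = {boolval L True, boolval L False}"
    and coincidence:
      "\<lbrakk>\<nu> \<in> vals L; \<mu> \<in> vals L; \<forall>x \<in> fv L \<phi>. \<nu> x = \<mu> x\<rbrakk> \<Longrightarrow> models L \<nu> \<phi> \<longleftrightarrow> models L \<mu> \<phi>"
    and models_rform: "\<nu> \<in> vals L \<Longrightarrow> models L \<nu> \<^bold>r \<longleftrightarrow> \<nu> (Cur (rvar L)) = boolval L True"
    and models_fls: "\<nu> \<in> vals L \<Longrightarrow> \<not> models L \<nu> \<^bold>\<bottom>"
    and models_neg: "\<nu> \<in> vals L \<Longrightarrow> models L \<nu> (\<^bold>\<not> \<phi>) \<longleftrightarrow> \<not> models L \<nu> \<phi>"
    and models_conj: "\<nu> \<in> vals L \<Longrightarrow> models L \<nu> (\<phi> \<^bold>\<and> \<psi>) \<longleftrightarrow> models L \<nu> \<phi> \<and> models L \<nu> \<psi>"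
    and models_disj: "\<nu> \<in> vals L \<Longrightarrow> models L \<nu> (\<phi> \<^bold>\<or> \<psi>) \<longleftrightarrow> models L \<nu> \<phi> \<or> models L \<nu> \<psi>"
    and models_imp: "\<nu> \<in> vals L \<Longrightarrow> models L \<nu> (\<phi> \<^bold>\<longrightarrow> \<psi>) \<longleftrightarrow> (models L \<nu> \<phi> \<longrightarrow> models L \<nu> \<psi>)"
    and models_exs:
      "\<nu> \<in> vals L \<Longrightarrow>
        models L \<nu> (exs L X \<phi>) \<longleftrightarrow> (\<exists>\<mu> \<in> vals L. (\<forall>x. x \<notin> X \<longrightarrow> \<mu> x = \<nu> x) \<and> models L \<mu> \<phi>)"
    and models_prime:
      "\<nu> \<in> vals L \<Longrightarrow> models L \<nu> (prime L \<phi>) \<longleftrightarrow> models L (\<lambda>x. \<nu> (Nxt (base x))) \<phi>"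
    and models_unprime:
      "\<nu> \<in> vals L \<Longrightarrow> models L \<nu> (unprime L \<phi>) \<longleftrightarrow> models L (\<lambda>x. \<nu> (Cur (base x))) \<phi>"
    and fv_rform: "fv L \<^bold>r \<subseteq> {Cur (rvar L)}"
    and fv_fls: "fv L \<^bold>\<bottom> = {}"
    and fv_neg: "fv L (\<^bold>\<not> \<phi>) \<subseteq> fv L \<phi>"
    and fv_conj: "fv L (\<phi> \<^bold>\<and> \<psi>) \<subseteq> fv L \<phi> \<union> fv L \<psi>"
    and fv_disj: "fv L (\<phi> \<^bold>\<or> \<psi>) \<subseteq> fv L \<phi> \<union> fv L \<psi>"
    and fv_imp: "fv L (\<phi> \<^bold>\<longrightarrow> \<psi>) \<subseteq> fv L \<phi> \<union> fv L \<psi>"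
    and fv_exs: "fv L (exs L X \<phi>) \<subseteq> fv L \<phi> - X"
    and fv_prime: "fv L (prime L \<phi>) \<subseteq> (\<lambda>x. Nxt (base x)) ` fv L \<phi>"
    and fv_unprime: "fv L (unprime L \<phi>) \<subseteq> (\<lambda>x. Cur (base x)) ` fv L \<phi>"

section \<open>Reachability games\<close>

record 'f game =
  Init :: 'f
  Safe :: 'f
  Reach :: 'f
  Goal :: 'f

datatype player = REACH | SAFE

fun move_pred :: "'f game \<Rightarrow> player \<Rightarrow> 'f" where
  "move_pred G REACH = Reach G"
| "move_pred G SAFE = Safe G"

context
  fixes L :: "('f, 'v, 'd) logic_sig" (structure)
begin

definition satisfiable :: "'f \<Rightarrow> bool" where
  "satisfiable \<phi> \<longleftrightarrow> (\<exists>\<nu> \<in> vals L. models L \<nu> \<phi>)"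

definition valid :: "'f \<Rightarrow> bool" where
  "valid \<phi> \<longleftrightarrow> (\<forall>\<nu> \<in> vals L. models L \<nu> \<phi>)"

definition interpolation :: "('f \<Rightarrow> 'f \<Rightarrow> 'f) \<Rightarrow> bool" where
  "interpolation itp \<longleftrightarrow>
    (\<forall>\<alpha> \<beta>. \<not> satisfiable (\<alpha> \<^bold>\<and> \<beta>) \<longrightarrow>
      valid (\<beta> \<^bold>\<longrightarrow> itp \<alpha> \<beta>) \<and> \<not> satisfiable (itp \<alpha> \<beta> \<^bold>\<and> \<alpha>) \<and>
      fv L (itp \<alpha> \<beta>) \<subseteq> fv L \<alpha> \<inter> fv L \<beta>)"

definition states :: "('v \<Rightarrow> 'd) set" where
  "states = {s. \<forall>v. s v \<in> domain L v}"

fun owned :: "player \<Rightarrow> ('v \<Rightarrow> 'd) set" where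
  "owned REACH = {s \<in> states. s (rvar L) = boolval L True}"
| "owned SAFE = states - {s \<in> states. s (rvar L) = boolval L True}"

definition holds2 :: "'f \<Rightarrow> ('v \<Rightarrow> 'd) \<Rightarrow> ('v \<Rightarrow> 'd) \<Rightarrow> bool" where
  "holds2 \<tau> s s' \<longleftrightarrow> models L (case_pvar s s') \<tau>"

text \<open>For a state predicate the values given to the primed variables are irrelevant.\<close>

definition holds :: "'f \<Rightarrow> ('v \<Rightarrow> 'd) \<Rightarrow> bool" where
  "holds \<phi> s \<longleftrightarrow> holds2 \<phi> s s"

definition state_pred :: "'f \<Rightarrow> bool" where
  "state_pred \<phi> \<longleftrightarrow> fv L \<phi> \<subseteq> range Cur"

definition reachability_game :: "'f game \<Rightarrow> bool" where
  "reachability_game G \<longleftrightarrow>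
    state_pred (Init G) \<and> state_pred (Goal G) \<and>
    valid (Safe G \<^bold>\<longrightarrow> \<^bold>\<not> \<^bold>r) \<and> valid (Reach G \<^bold>\<longrightarrow> \<^bold>r)"

definition trap :: "'f game \<Rightarrow> ('v \<Rightarrow> 'd) \<Rightarrow> bool" where
  "trap G s \<longleftrightarrow> \<not> (\<exists>s' \<in> states. holds2 (Safe G \<^bold>\<or> Reach G) s s')"

text \<open>
  A play is given by its length \<open>n\<close>, possibly infinite, and a function of which only the
  values at positions below \<open>n\<close> matter.
\<close>

definition play :: "'f game \<Rightarrow> ('v \<Rightarrow> 'd) \<Rightarrow> enat \<Rightarrow> (nat \<Rightarrow> 'v \<Rightarrow> 'd) \<Rightarrow> bool" where
  "play G s n \<pi> \<longleftrightarrow>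
    0 < n \<and> \<pi> 0 = s \<and>
    (\<forall>i. enat i < n \<longrightarrow> \<pi> i \<in> states) \<and>
    (\<forall>i. enat (Suc i) < n \<longrightarrow>
      holds2 (Safe G) (\<pi> i) (\<pi> (Suc i)) \<or> holds2 (Reach G) (\<pi> i) (\<pi> (Suc i))) \<and>
    (\<forall>k. n = enat (Suc k) \<longrightarrow> trap G (\<pi> k))"

fun wins_play :: "'f game \<Rightarrow> player \<Rightarrow> enat \<Rightarrow> (nat \<Rightarrow> 'v \<Rightarrow> 'd) \<Rightarrow> bool" where
  "wins_play G REACH n \<pi> \<longleftrightarrow> (\<exists>i. enat i < n \<and> holds (Goal G) (\<pi> i))"
| "wins_play G SAFE n \<pi> \<longleftrightarrow> \<not> (\<exists>i. enat i < n \<and> holds (Goal G) (\<pi> i))"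

definition strategy :: "'f game \<Rightarrow> player \<Rightarrow> (('v \<Rightarrow> 'd) list \<Rightarrow> 'v \<Rightarrow> 'd) \<Rightarrow> bool" where
  "strategy G p \<sigma> \<longleftrightarrow>
    (\<forall>w s. set w \<subseteq> states \<and> s \<in> owned p \<longrightarrow>
      \<sigma> (w @ [s]) \<in> states \<and> (\<not> trap G s \<longrightarrow> holds2 (move_pred G p) s (\<sigma> (w @ [s]))))"

definition consistent ::
  "player \<Rightarrow> (('v \<Rightarrow> 'd) list \<Rightarrow> 'v \<Rightarrow> 'd) \<Rightarrow> enat \<Rightarrow> (nat \<Rightarrow> 'v \<Rightarrow> 'd) \<Rightarrow> bool" where
  "consistent p \<sigma> n \<pi> \<longleftrightarrow>
    (\<forall>i. enat (Suc i) < n \<and> \<pi> i \<in> owned p \<longrightarrow> \<pi> (Suc i) = \<sigma> (map \<pi> [0..<Suc i]))"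

definition wins_from :: "'f game \<Rightarrow> player \<Rightarrow> ('v \<Rightarrow> 'd) \<Rightarrow> bool" where
  "wins_from G p s \<longleftrightarrow>
    (\<exists>\<sigma>. strategy G p \<sigma> \<and>
      (\<forall>n \<pi>. play G s n \<pi> \<and> consistent p \<sigma> n \<pi> \<longrightarrow> wins_play G p n \<pi>))"

subsection \<open>Symbolic strategies\<close>

definition symbolic_strategy :: "'f game \<Rightarrow> 'f \<Rightarrow> bool" where
  "symbolic_strategy G \<SS> \<longleftrightarrow> valid (\<SS> \<^bold>\<longrightarrow> Safe G \<^bold>\<or> Reach G)"

definition play_prefix :: "'f game \<Rightarrow> ('v \<Rightarrow> 'd) \<Rightarrow> ('v \<Rightarrow> 'd) list \<Rightarrow> bool" where
  "play_prefix G s xs \<longleftrightarrow>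
    xs \<noteq> [] \<and>
    (\<exists>n \<pi>. play G s n \<pi> \<and> enat (length xs) \<le> n \<and> xs = map \<pi> [0..<length xs]) \<and>
    (\<forall>x \<in> set xs. \<not> holds (Goal G) x) \<and> \<not> trap G (last xs)"

definition conforms_list :: "player \<Rightarrow> 'f \<Rightarrow> ('v \<Rightarrow> 'd) list \<Rightarrow> bool" where
  "conforms_list p \<SS> xs \<longleftrightarrow>
    (\<forall>j. Suc j < length xs \<and> xs ! j \<in> owned p \<longrightarrow> holds2 \<SS> (xs ! j) (xs ! Suc j))"

text \<open>
  A play conforms to \<open>\<SS>\<close> if every move out of one of its play prefixes does: the one-step
  extension of each play prefix has to conform.  Demanding conformance of the play prefixes
  only would leave exactly the moves into goal and trap states unconstrained, because no play
  prefix contains such a move, and then no symbolic strategy could win in a state in which its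
  player also has a losing move of this kind.
\<close>

definition conforms_play ::
  "'f game \<Rightarrow> player \<Rightarrow> 'f \<Rightarrow> ('v \<Rightarrow> 'd) \<Rightarrow> enat \<Rightarrow> (nat \<Rightarrow> 'v \<Rightarrow> 'd) \<Rightarrow> bool" where
  "conforms_play G p \<SS> s n \<pi> \<longleftrightarrow>
    (\<forall>k. enat k < n \<and> play_prefix G s (map \<pi> [0..<k]) \<longrightarrow> conforms_list p \<SS> (map \<pi> [0..<Suc k]))"

definition symbolic_winning :: "'f game \<Rightarrow> player \<Rightarrow> 'f \<Rightarrow> ('v \<Rightarrow> 'd) \<Rightarrow> bool" where
  "symbolic_winning G p \<SS> s \<longleftrightarrow>
    (\<forall>n \<pi>. play G s n \<pi> \<and> conforms_play G p \<SS> s n \<pi> \<longrightarrow> wins_play G p n \<pi>) \<and>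
    (\<forall>xs. play_prefix G s xs \<and> conforms_list p \<SS> xs \<and> last xs \<in> owned p \<longrightarrow>
      (\<exists>s' \<in> states. holds2 (\<SS> \<^bold>\<and> move_pred G p) (last xs) s'))"

section \<open>The procedure\<close>

definition Pre :: "'f \<Rightarrow> 'f" where
  "Pre T = exs L (range Nxt) T"

definition Post :: "'f \<Rightarrow> 'f" where
  "Post T = exs L (range Cur) T"

definition Instantiate :: "'f \<Rightarrow> 'f game \<Rightarrow> 'f" where
  "Instantiate \<phi> G = (Safe G \<^bold>\<or> Reach G) \<^bold>\<and> \<^bold>\<not> \<phi> \<^bold>\<and> prime L \<phi>"

definition Enf :: "'f \<Rightarrow> 'f game \<Rightarrow> 'f" where
  "Enf T G = (Safe G \<^bold>\<or> Reach G) \<^bold>\<and> T \<^bold>\<and> \<^bold>\<not> exs L (range Nxt) (Safe G \<^bold>\<and> \<^bold>\<not> T)"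

definition combine :: "'f \<Rightarrow> 'f \<Rightarrow> 'f \<Rightarrow> 'f" where
  "combine A F B =
    (Pre B \<^bold>\<longrightarrow> B) \<^bold>\<and>
    (\<^bold>\<not> Pre B \<^bold>\<and> Pre F \<^bold>\<longrightarrow> F) \<^bold>\<and>
    (\<^bold>\<not> Pre B \<^bold>\<and> \<^bold>\<not> Pre F \<^bold>\<longrightarrow> A) \<^bold>\<and>
    (Pre B \<^bold>\<or> Pre F \<^bold>\<or> Pre A)"

definition post_game :: "'f \<Rightarrow> 'f \<Rightarrow> 'f game \<Rightarrow> 'f game" where
  "post_game \<phi> C G =
    \<lparr>Init = unprime L (Post C), Safe = Safe G \<^bold>\<and> \<phi>, Reach = Reach G \<^bold>\<and> \<phi>, Goal = Goal G\<rparr>"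

definition pre_game :: "'f \<Rightarrow> 'f \<Rightarrow> 'f game \<Rightarrow> 'f game" where
  "pre_game I F G =
    \<lparr>Init = I, Safe = Safe G \<^bold>\<and> \<^bold>\<not> F, Reach = Reach G \<^bold>\<and> \<^bold>\<not> F, Goal = Pre (Enf F G)\<rparr>"

text \<open>
  \<open>returns itp G R SR SS\<close>: the procedure, run on \<open>G\<close> with interpolation function \<open>itp\<close>,
  terminates and returns the triple \<open>(R, SR, SS)\<close>.

  In the last rule, when \<open>\<phi> \<and> \<not> Goal\<close> can be left, \<open>F\<close> is extended by the transitions of
  \<open>G\<close> that lead to \<open>Goal\<close>.  Adding the bare formula \<open>Goal[V/V']\<close> instead would make no
  semantic difference to \<open>pre_game\<close>, where \<open>F\<close> is only used relative to \<open>Safe\<close> and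
  \<open>Reach\<close>, but it would spoil \<open>combine\<close>: \<open>Pre F\<close> would hold everywhere as soon as \<open>Goal\<close>
  is satisfiable, and \<open>combine\<close> would select non-transitions in place of the moves of \<open>A\<close>.
\<close>

inductive returns :: "('f \<Rightarrow> 'f \<Rightarrow> 'f) \<Rightarrow> 'f game \<Rightarrow> 'f \<Rightarrow> 'f \<Rightarrow> 'f \<Rightarrow> bool"
  for itp :: "'f \<Rightarrow> 'f \<Rightarrow> 'f"
where
  all_goal:
    "\<lbrakk>R = Init G \<^bold>\<and> Goal G; I = Init G \<^bold>\<and> \<^bold>\<not> Goal G;
      \<not> satisfiable I\<rbrakk>
     \<Longrightarrow> returns itp G R \<^bold>\<bottom> \<^bold>\<bottom>"
| no_enforceable_subgoal:
    "\<lbrakk>R = Init G \<^bold>\<and> Goal G; I = Init G \<^bold>\<and> \<^bold>\<not> Goal G;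
      satisfiable I;
      \<phi> = itp I (Goal G); C = Instantiate \<phi> G;
      \<not> satisfiable (Enf C G)\<rbrakk>
     \<Longrightarrow> returns itp G R \<^bold>\<bottom> (Safe G \<^bold>\<and> \<^bold>\<not> C)"
| no_winning_subgoal:
    "\<lbrakk>R = Init G \<^bold>\<and> Goal G; I = Init G \<^bold>\<and> \<^bold>\<not> Goal G;
      satisfiable I;
      \<phi> = itp I (Goal G); C = Instantiate \<phi> G;
      satisfiable (Enf C G);
      returns itp (post_game \<phi> C G) R\<^sub>p\<^sub>o\<^sub>s\<^sub>t SR\<^sub>p\<^sub>o\<^sub>s\<^sub>t SS\<^sub>p\<^sub>o\<^sub>s\<^sub>t;
      F = C \<^bold>\<and> prime L R\<^sub>p\<^sub>o\<^sub>s\<^sub>t;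
      \<not> satisfiable (Enf F G)\<rbrakk>
     \<Longrightarrow> returns itp G R \<^bold>\<bottom> (Safe G \<^bold>\<and> \<^bold>\<not> F \<^bold>\<and> (\<phi> \<^bold>\<longrightarrow> SS\<^sub>p\<^sub>o\<^sub>s\<^sub>t))"
| recurse:
    "\<lbrakk>R = Init G \<^bold>\<and> Goal G; I = Init G \<^bold>\<and> \<^bold>\<not> Goal G;
      satisfiable I;
      \<phi> = itp I (Goal G); C = Instantiate \<phi> G;
      satisfiable (Enf C G);
      returns itp (post_game \<phi> C G) R\<^sub>p\<^sub>o\<^sub>s\<^sub>t SR\<^sub>p\<^sub>o\<^sub>s\<^sub>t SS\<^sub>p\<^sub>o\<^sub>s\<^sub>t;
      F = C \<^bold>\<and> prime L R\<^sub>p\<^sub>o\<^sub>s\<^sub>t;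
      satisfiable (Enf F G);
      (F', \<phi>') =
        (if satisfiable ((Reach G \<^bold>\<or> Safe G) \<^bold>\<and> \<phi> \<^bold>\<and> \<^bold>\<not> prime L \<phi> \<^bold>\<and> \<^bold>\<not> Goal G)
         then (F \<^bold>\<or> (Safe G \<^bold>\<or> Reach G) \<^bold>\<and> prime L (Goal G), \<^bold>\<bottom>)
         else (F, \<phi>));
      returns itp (pre_game I F' G) R\<^sub>p\<^sub>r\<^sub>e SR\<^sub>p\<^sub>r\<^sub>e SS\<^sub>p\<^sub>r\<^sub>e\<rbrakk>
     \<Longrightarrow> returns itp G (R \<^bold>\<or> R\<^sub>p\<^sub>r\<^sub>e) (combine SR\<^sub>p\<^sub>r\<^sub>e F' SR\<^sub>p\<^sub>o\<^sub>s\<^sub>t)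
          ((\<^bold>\<not> \<phi>' \<^bold>\<longrightarrow> SS\<^sub>p\<^sub>r\<^sub>e) \<^bold>\<and> (\<phi>' \<^bold>\<longrightarrow> SS\<^sub>p\<^sub>o\<^sub>s\<^sub>t))"

end

end

theory Submission
  imports Defs
begin

text \<open>
  For a symbolic strategy \<open>T\<close> of REACH, the states from which all plays following \<open>T\<close> reach
  the goal form an attractor (a least fixed point); for SAFE, the states from which \<open>T\<close> avoids the
  goal form an invariant (a greatest fixed point).  One shows by induction on the run of the
  procedure that \<open>R\<close> lies in the attractor of the returned reachability strategy and
  \<open>Init \<and> \<not> R\<close> in an invariant of the returned safety strategy.

  Every play from \<open>I\<close> to the goal crosses from \<open>\<not> \<phi>\<close> to \<open>\<phi>\<close>.  A crossing into \<open>R\<^sub>p\<^sub>o\<^sub>s\<^sub>t\<close>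
  is won by the strategy of the post game, so REACH wins once it can enforce \<open>F\<close>, the goal of
  the pre game.  A crossing outside \<open>R\<^sub>p\<^sub>o\<^sub>s\<^sub>t\<close> enters the invariant of the post game.  If no
  move leaves \<open>\<phi> \<and> \<not> Goal\<close> for \<open>\<not> \<phi>\<close>, the invariants of the two subgames, taken on \<open>\<not> \<phi>\<close> and on
  \<open>\<phi>\<close>, together form an invariant; otherwise the moves into the goal are added to \<open>F\<close>, and
  the invariant of the pre game, minus the goal, suffices.
\<close>

section \<open>Semantics of formulas over pairs of states\<close>

context reach_logic
begin

lemma case_pvar_in_vals: "\<lbrakk>x \<in> states L; y \<in> states L\<rbrakk> \<Longrightarrow> case_pvar x y \<in> vals L"
  by (auto simp: vals_def states_def split: pvar.split)

text \<open>A valuation splits into its unprimed and its primed half, each of which is a state. This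
  turns satisfiability and validity into statements about pairs of states, the form used from here
  on.\<close>

lemma vals_cases:
  assumes "\<nu> \<in> vals L"
  obtains x y where "x \<in> states L" "y \<in> states L" "\<nu> = case_pvar x y"
proof
  show "(\<lambda>v. \<nu> (Cur v)) \<in> states L" "(\<lambda>v. \<nu> (Nxt v)) \<in> states L"
    using assms by (auto simp: vals_def states_def dest: spec[of _ "Cur _"] spec[of _ "Nxt _"])
  show "\<nu> = case_pvar (\<lambda>v. \<nu> (Cur v)) (\<lambda>v. \<nu> (Nxt v))"
    by (auto split: pvar.split)
qed

lemma satisfiable_iff: "satisfiable L \<phi> \<longleftrightarrow> (\<exists>x \<in> states L. \<exists>y \<in> states L. holds2 L \<phi> x y)"
  unfolding satisfiable_def holds2_def by (metis vals_cases case_pvar_in_vals)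

lemma valid_iff: "valid L \<phi> \<longleftrightarrow> (\<forall>x \<in> states L. \<forall>y \<in> states L. holds2 L \<phi> x y)"
  unfolding valid_def holds2_def by (metis vals_cases case_pvar_in_vals)

context
  fixes x y
  assumes xy: "x \<in> states L" "y \<in> states L"
begin

lemma holds2_connectives:
  "\<not> holds2 L \<^bold>\<bottom> x y"
  "holds2 L (\<^bold>\<not> \<phi>) x y \<longleftrightarrow> \<not> holds2 L \<phi> x y"
  "holds2 L (\<phi> \<^bold>\<and> \<psi>) x y \<longleftrightarrow> holds2 L \<phi> x y \<and> holds2 L \<psi> x y"
  "holds2 L (\<phi> \<^bold>\<or> \<psi>) x y \<longleftrightarrow> holds2 L \<phi> x y \<or> holds2 L \<psi> x y"
  "holds2 L (\<phi> \<^bold>\<longrightarrow> \<psi>) x y \<longleftrightarrow> (holds2 L \<phi> x y \<longrightarrow> holds2 L \<psi> x y)"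
  using case_pvar_in_vals[OF xy]
  by (simp_all add: holds2_def models_fls models_neg models_conj models_disj models_imp)

lemma holds2_rform: "holds2 L \<^bold>r x y \<longleftrightarrow> x \<in> owned L REACH"
  using case_pvar_in_vals[OF xy] xy by (simp add: holds2_def models_rform)

lemma holds2_prime: "holds2 L (prime L \<phi>) x y \<longleftrightarrow> holds L \<phi> y"
proof -
  have "(\<lambda>v. case_pvar x y (Nxt (base v))) = case_pvar y y"
    by (auto split: pvar.split)
  then show ?thesis
    using case_pvar_in_vals[OF xy] by (simp add: holds_def holds2_def models_prime)
qed

lemma holds2_unprime: "holds2 L (unprime L \<phi>) x y \<longleftrightarrow> holds L \<phi> x"
proof -
  have "(\<lambda>v. case_pvar x y (Cur (base v))) = case_pvar x x"
    by (auto split: pvar.split)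
  then show ?thesis
    using case_pvar_in_vals[OF xy] by (simp add: holds_def holds2_def models_unprime)
qed

lemma holds2_exs_Nxt: "holds2 L (exs L (range Nxt) \<phi>) x y \<longleftrightarrow> (\<exists>z \<in> states L. holds2 L \<phi> x z)"
proof
  assume "holds2 L (exs L (range Nxt) \<phi>) x y"
  then obtain \<mu> where \<mu>: "\<mu> \<in> vals L" "\<And>v. v \<notin> range Nxt \<Longrightarrow> \<mu> v = case_pvar x y v" "models L \<mu> \<phi>"
    using case_pvar_in_vals[OF xy] by (auto simp: holds2_def models_exs)
  obtain x' z where z: "z \<in> states L" "\<mu> = case_pvar x' z"
    using \<mu>(1) by (rule vals_cases)
  \<comment> \<open>Only primed variables are quantified, so the changed valuation keeps its first
    component and amounts to a new choice of successor.\<close>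
  have "x' v = x v" for v
    using \<mu>(2)[of "Cur v"] z by auto
  then have "x' = x" ..
  then show "\<exists>z \<in> states L. holds2 L \<phi> x z"
    using z \<mu>(3) by (auto simp: holds2_def)
next
  assume "\<exists>z \<in> states L. holds2 L \<phi> x z"
  then obtain z where "z \<in> states L" "models L (case_pvar x z) \<phi>"
    by (auto simp: holds2_def)
  moreover have "\<forall>v. v \<notin> range Nxt \<longrightarrow> case_pvar x z v = case_pvar x y v"
    by (auto split: pvar.split)
  ultimately show "holds2 L (exs L (range Nxt) \<phi>) x y"
    using case_pvar_in_vals[OF xy] case_pvar_in_vals[OF xy(1)] by (auto simp: holds2_def models_exs)
qed

lemma holds2_exs_Cur: "holds2 L (exs L (range Cur) \<phi>) x y \<longleftrightarrow> (\<exists>z \<in> states L. holds2 L \<phi> z y)"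
proof
  assume "holds2 L (exs L (range Cur) \<phi>) x y"
  then obtain \<mu> where \<mu>: "\<mu> \<in> vals L" "\<And>v. v \<notin> range Cur \<Longrightarrow> \<mu> v = case_pvar x y v" "models L \<mu> \<phi>"
    using case_pvar_in_vals[OF xy] by (auto simp: holds2_def models_exs)
  obtain z y' where z: "z \<in> states L" "\<mu> = case_pvar z y'"
    using \<mu>(1) by (rule vals_cases)
  have "y' v = y v" for v
    using \<mu>(2)[of "Nxt v"] z by auto
  then have "y' = y" ..
  then show "\<exists>z \<in> states L. holds2 L \<phi> z y"
    using z \<mu>(3) by (auto simp: holds2_def)
next
  assume "\<exists>z \<in> states L. holds2 L \<phi> z y"
  then obtain z where "z \<in> states L" "models L (case_pvar z y) \<phi>"
    by (auto simp: holds2_def)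
  moreover have "\<forall>v. v \<notin> range Cur \<longrightarrow> case_pvar z y v = case_pvar x y v"
    by (auto split: pvar.split)
  ultimately show "holds2 L (exs L (range Cur) \<phi>) x y"
    using case_pvar_in_vals[OF xy] case_pvar_in_vals[OF _ xy(2)] by (auto simp: holds2_def models_exs)
qed

lemma holds2_state_pred:
  assumes "state_pred L \<phi>"
  shows "holds2 L \<phi> x y \<longleftrightarrow> holds L \<phi> x"
  unfolding holds_def holds2_def
proof (rule coincidence)
  show "\<forall>v \<in> fv L \<phi>. case_pvar x y v = case_pvar x x v"
    using assms by (auto simp: state_pred_def)
qed (use case_pvar_in_vals xy in auto)

end

lemmas holds2_simps =
  holds2_connectives holds2_rform holds2_prime holds2_unprime holds2_exs_Nxt holds2_exs_Cur

lemma holds_simps: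
  assumes "x \<in> states L"
  shows "holds L (\<^bold>\<not> \<phi>) x \<longleftrightarrow> \<not> holds L \<phi> x"
    and "holds L (\<phi> \<^bold>\<and> \<psi>) x \<longleftrightarrow> holds L \<phi> x \<and> holds L \<psi> x"
    and "holds L (\<phi> \<^bold>\<or> \<psi>) x \<longleftrightarrow> holds L \<phi> x \<or> holds L \<psi> x"
  using assms by (simp_all add: holds_def holds2_simps)

lemma state_pred_neg: "state_pred L \<phi> \<Longrightarrow> state_pred L (\<^bold>\<not> \<phi>)"
  using fv_neg[of \<phi>] by (auto simp: state_pred_def)

lemma state_pred_conj: "\<lbrakk>state_pred L \<phi>; state_pred L \<psi>\<rbrakk> \<Longrightarrow> state_pred L (\<phi> \<^bold>\<and> \<psi>)"
  using fv_conj[of \<phi> \<psi>] by (auto simp: state_pred_def)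

lemma state_pred_Pre: "state_pred L (Pre L \<phi>)"
proof -
  have "v \<in> range Cur" if "v \<notin> range Nxt" for v :: "'v pvar"
    using that by (cases v) auto
  then show ?thesis
    using fv_exs[of "range Nxt" \<phi>] by (auto simp: state_pred_def Pre_def)
qed

lemma state_pred_unprime: "state_pred L (unprime L \<phi>)"
  using fv_unprime[of \<phi>] by (auto simp: state_pred_def)

text \<open>The interpolant is a state predicate because its variables are among those of
  \<open>\<psi>\<close>; the two implications come from evaluating at the pair \<open>x\<close>,
  \<open>x\<close>. With the initial non-goal states for \<open>\<chi>\<close> and the goal for
  \<open>\<psi>\<close>, it separates start from goal.\<close>

lemma interpolant_of_conflict:
  assumes "interpolation L itp" "state_pred L \<psi>"
    and "\<And>x y. \<lbrakk>x \<in> states L; y \<in> states L; holds2 L \<chi> x y; holds2 L \<psi> x y\<rbrakk> \<Longrightarrow> False"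
  shows "state_pred L (itp \<chi> \<psi>)"
    and "\<lbrakk>x \<in> states L; holds L \<psi> x\<rbrakk> \<Longrightarrow> holds L (itp \<chi> \<psi>) x"
    and "\<lbrakk>x \<in> states L; holds L \<chi> x\<rbrakk> \<Longrightarrow> \<not> holds L (itp \<chi> \<psi>) x"
proof -
  have "\<not> satisfiable L (\<chi> \<^bold>\<and> \<psi>)"
    using assms(3) by (auto simp: satisfiable_iff holds2_simps)
  then have *: "valid L (\<psi> \<^bold>\<longrightarrow> itp \<chi> \<psi>)" "\<not> satisfiable L (itp \<chi> \<psi> \<^bold>\<and> \<chi>)" "fv L (itp \<chi> \<psi>) \<subseteq> fv L \<psi>"
    using assms(1) by (auto simp: interpolation_def)
  show "state_pred L (itp \<chi> \<psi>)"
    using *(3) assms(2) by (auto simp: state_pred_def)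
  show "holds L (itp \<chi> \<psi>) x" if "x \<in> states L" "holds L \<psi> x"
    using *(1) that by (auto simp: valid_iff holds2_simps holds_def)
  show "\<not> holds L (itp \<chi> \<psi>) x" if "x \<in> states L" "holds L \<chi> x"
    using *(2) that by (auto simp: satisfiable_iff holds2_simps holds_def)
qed

section \<open>Moves, attractors and invariants\<close>

definition move :: "'f game \<Rightarrow> ('v \<Rightarrow> 'd) \<Rightarrow> ('v \<Rightarrow> 'd) \<Rightarrow> bool" where
  "move G x y \<longleftrightarrow> x \<in> states L \<and> y \<in> states L \<and> holds2 L (Safe G \<^bold>\<or> Reach G) x y"

text \<open>The opponent of \<open>p\<close> keeps all moves of the game. Quantifying over these
  moves therefore covers the choices left to \<open>p\<close> by \<open>T\<close> and those of the
  adversary alike.\<close>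

definition strat_move :: "'f game \<Rightarrow> player \<Rightarrow> 'f \<Rightarrow> ('v \<Rightarrow> 'd) \<Rightarrow> ('v \<Rightarrow> 'd) \<Rightarrow> bool" where
  "strat_move G p T x y \<longleftrightarrow> move G x y \<and> (x \<in> owned L p \<longrightarrow> holds2 L T x y)"

text \<open>The witness \<open>z\<close> in \<open>step\<close> keeps out non-goal states that would
  be attracted vacuously: traps, and states of REACH where \<open>T\<close> offers no move.\<close>

inductive reach_attr :: "'f game \<Rightarrow> 'f \<Rightarrow> ('v \<Rightarrow> 'd) \<Rightarrow> bool" for G T where
  goal: "holds L (Goal G) x \<Longrightarrow> reach_attr G T x"
| step: "\<lbrakk>strat_move G REACH T x z; \<And>y. strat_move G REACH T x y \<Longrightarrow> reach_attr G T y\<rbrakk>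
    \<Longrightarrow> reach_attr G T x"

text \<open>The greatest fixed point is written as membership in some closed set \<open>W\<close>.
  The last clause says that \<open>T\<close> never blocks SAFE in a state that is not a trap, as
  winning symbolic strategies require.\<close>

definition safe_inv :: "'f game \<Rightarrow> 'f \<Rightarrow> ('v \<Rightarrow> 'd) \<Rightarrow> bool" where
  "safe_inv G T s \<longleftrightarrow> (\<exists>W. s \<in> W \<and> (\<forall>x \<in> W. \<not> holds L (Goal G) x \<and>
    (\<forall>y. strat_move G SAFE T x y \<longrightarrow> y \<in> W) \<and>
    ((\<exists>y. move G x y) \<longrightarrow> (\<exists>y. strat_move G SAFE T x y))))"

lemma safe_invI:
  assumes "P s"
    and "\<And>x. P x \<Longrightarrow> \<not> holds L (Goal G) x"
    and "\<And>x y. \<lbrakk>P x; strat_move G SAFE T x y\<rbrakk> \<Longrightarrow> P y"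
    and "\<And>x y. \<lbrakk>P x; move G x y\<rbrakk> \<Longrightarrow> \<exists>y. strat_move G SAFE T x y"
  shows "safe_inv G T s"
  unfolding safe_inv_def using assms by (intro exI[of _ "Collect P"]) blast

lemma safe_inv_not_goal: "safe_inv G T x \<Longrightarrow> \<not> holds L (Goal G) x"
  unfolding safe_inv_def by blast

lemma safe_inv_next: "\<lbrakk>safe_inv G T x; strat_move G SAFE T x y\<rbrakk> \<Longrightarrow> safe_inv G T y"
  unfolding safe_inv_def by blast

lemma safe_inv_ex: "\<lbrakk>safe_inv G T x; move G x y\<rbrakk> \<Longrightarrow> \<exists>y. strat_move G SAFE T x y"
  unfolding safe_inv_def by blast

lemma trap_iff: "x \<in> states L \<Longrightarrow> trap L G x \<longleftrightarrow> \<not> (\<exists>y. move G x y)"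
  by (auto simp: trap_def move_def)

lemma owned_SAFE_iff: "x \<in> states L \<Longrightarrow> x \<in> owned L SAFE \<longleftrightarrow> x \<notin> owned L REACH"
  by auto

lemma owned_states: "x \<in> owned L p \<Longrightarrow> x \<in> states L"
  by (cases p) auto

text \<open>\<open>Safe\<close> implies that \<open>r\<close> is false and \<open>Reach\<close> that
  it is true, so the owner of \<open>x\<close> decides which disjunct of a move can hold.\<close>

lemma move_pred_iff:
  assumes "reachability_game L G" "x \<in> owned L p" "y \<in> states L"
  shows "holds2 L (move_pred G p) x y \<longleftrightarrow> move G x y"
proof -
  have x: "x \<in> states L"
    using assms(2) by (rule owned_states)
  have "holds2 L (Safe G) x y \<Longrightarrow> x \<notin> owned L REACH" "holds2 L (Reach G) x y \<Longrightarrow> x \<in> owned L REACH"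
    using assms x by (auto simp: reachability_game_def valid_iff holds2_simps simp del: owned.simps)
  then show ?thesis
    using assms(2,3) x by (cases p) (auto simp: move_def holds2_simps)
qed

lemma move_states: "move G x y \<Longrightarrow> x \<in> states L \<and> y \<in> states L"
  by (simp add: move_def)

lemma strat_move_move: "strat_move G p T x y \<Longrightarrow> move G x y"
  by (simp add: strat_move_def)

section \<open>Attractors and invariants witness winning strategies\<close>

context
  fixes G s n \<pi>
  assumes play: "play L G s n \<pi>"
begin

lemma play_move:
  assumes "enat (Suc i) < n"
  shows "move G (\<pi> i) (\<pi> (Suc i))"
proof -
  have "enat i < n"
    using assms by (metis enat_ord_simps(2) lessI order_less_trans)
  then show ?thesis
    using play assms by (auto simp: play_def move_def holds2_simps)
qed

lemma play_continues:
  assumes "enat i < n" "move G (\<pi> i) y"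
  shows "enat (Suc i) < n"
proof (rule ccontr)
  assume "\<not> enat (Suc i) < n"
  then have "n = enat (Suc i)"
    using assms(1) by (metis Suc_ile_eq order_le_less)
  then have "trap L G (\<pi> i)"
    using play by (auto simp: play_def)
  then show False
    using assms(2) trap_iff move_states by blast
qed

text \<open>The history up to \<open>i\<close> is goal-free and does not end in a trap, since the
  play moves on. It is thus a play prefix, and conformance constrains its one-step
  extension.\<close>

lemma play_conforming_move:
  assumes "conforms_play L G p T s n \<pi>" "enat (Suc i) < n"
    and "\<And>j. j \<le> i \<Longrightarrow> \<not> holds L (Goal G) (\<pi> j)"
  shows "strat_move G p T (\<pi> i) (\<pi> (Suc i))"
proof -
  have m: "move G (\<pi> i) (\<pi> (Suc i))"
    using assms(2) by (rule play_move)
  have "play_prefix L G s (map \<pi> [0..<Suc i])"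
    unfolding play_prefix_def
  proof (intro conjI exI)
    show "play L G s n \<pi>"
      by (rule play)
    show "enat (length (map \<pi> [0..<Suc i])) \<le> n"
      using assms(2) by simp
    show "\<forall>x \<in> set (map \<pi> [0..<Suc i]). \<not> holds L (Goal G) x"
      using assms(3) by auto
    show "\<not> trap L G (last (map \<pi> [0..<Suc i]))"
      using m move_states trap_iff by auto
  qed auto
  then have "conforms_list L p T (map \<pi> [0..<Suc (Suc i)])"
    using assms(1,2) unfolding conforms_play_def by blast
  then have "Suc i < length (map \<pi> [0..<Suc (Suc i)]) \<and> map \<pi> [0..<Suc (Suc i)] ! i \<in> owned L p \<longrightarrow>
      holds2 L T (map \<pi> [0..<Suc (Suc i)] ! i) (map \<pi> [0..<Suc (Suc i)] ! Suc i)"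
    unfolding conforms_list_def by blast
  then show ?thesis
    using m by (simp add: strat_move_def nth_append del: owned.simps)
qed

text \<open>A goal-free play inside the attractor would descend along its well-founded generation,
  which induction on the attractor excludes. Obedience to \<open>T\<close> is asked only where
  \<open>T\<close> offers a move; this fits conforming plays as well as plays of a strategy that
  improvises elsewhere.\<close>

lemma reach_attr_reaches_goal:
  assumes "reach_attr G T s"
    and strat: "\<And>i. \<lbrakk>enat (Suc i) < n; \<forall>j \<le> i. \<not> holds L (Goal G) (\<pi> j); \<exists>y. strat_move G REACH T (\<pi> i) y\<rbrakk>
      \<Longrightarrow> strat_move G REACH T (\<pi> i) (\<pi> (Suc i))"
  shows "wins_play L G REACH n \<pi>"
proof (rule ccontr)
  assume "\<not> wins_play L G REACH n \<pi>"
  then have no_goal: "\<not> holds L (Goal G) (\<pi> i)" if "enat i < n" for i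
    using that by auto
  have "False" if "reach_attr G T x" "enat i < n" "\<pi> i = x" for x i
    using that
  proof (induction arbitrary: i)
    case (goal x)
    then show ?case
      using no_goal by auto
  next
    case (step x z)
    then have i: "enat (Suc i) < n"
      using play_continues strat_move_move by blast
    have "\<forall>j \<le> i. \<not> holds L (Goal G) (\<pi> j)"
      using no_goal step.prems(1) by (meson enat_ord_simps(1) order_le_less_trans)
    then show ?case
      using strat[OF i] step i by blast
  qed
  then show False
    using assms(1) play by (auto simp: play_def zero_enat_def)
qed

end

text \<open>Transports a property along a conforming prefix. It serves both players, to show that
  the last state is still in the attractor or in the invariant.\<close>

lemma conforming_prefix_induct:
  assumes "play_prefix L G s xs" "conforms_list L p T xs" "P s"
    and "\<And>x y. \<lbrakk>P x; \<not> holds L (Goal G) x; strat_move G p T x y\<rbrakk> \<Longrightarrow> P y"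
  shows "P (last xs)"
proof -
  obtain n \<pi> where *: "play L G s n \<pi>" "enat (length xs) \<le> n" "xs = map \<pi> [0..<length xs]"
    using assms(1) by (auto simp: play_prefix_def)
  have nth: "xs ! j = \<pi> j" if "j < length xs" for j
    using that *(3) by (metis add_0 diff_zero nth_map_upt)
  have "j < length xs \<Longrightarrow> P (xs ! j)" for j
  proof (induction j)
    case 0
    then show ?case
      using assms(3) * nth[of 0] by (auto simp: play_def)
  next
    case (Suc j)
    have "enat (Suc j) < n"
      using Suc.prems *(2) by (meson enat_ord_simps(2) order_less_le_trans)
    then have "move G (xs ! j) (xs ! Suc j)"
      using play_move[OF *(1)] nth Suc.prems by simp
    then have "strat_move G p T (xs ! j) (xs ! Suc j)"
      using assms(2) Suc.prems by (auto simp: strat_move_def conforms_list_def simp del: owned.simps)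
    moreover have "\<not> holds L (Goal G) (xs ! j)"
      using assms(1) Suc.prems by (auto simp: play_prefix_def)
    ultimately show ?case
      using assms(4) Suc by auto
  qed
  moreover have "xs \<noteq> []"
    using assms(1) by (simp add: play_prefix_def)
  ultimately show ?thesis
    by (simp add: last_conv_nth)
qed

lemma strat_move_witness:
  assumes "reachability_game L G" "x \<in> owned L p" "strat_move G p T x y"
  shows "\<exists>y \<in> states L. holds2 L (T \<^bold>\<and> move_pred G p) x y"
proof
  show "y \<in> states L"
    using assms(3) by (auto dest: strat_move_move move_states)
  then show "holds2 L (T \<^bold>\<and> move_pred G p) x y"
    using assms by (simp add: holds2_simps owned_states move_pred_iff strat_move_def)
qed

text \<open>A conforming prefix stays in the attractor. Its last state is no goal, so it was
  attracted by \<open>step\<close>, whose witness is the move that the strategy has to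
  offer.\<close>

lemma reach_attr_symbolic_winning:
  assumes "reachability_game L G" "reach_attr G T s"
  shows "symbolic_winning L G REACH T s"
  unfolding symbolic_winning_def
proof (intro conjI allI impI; elim conjE)
  show "wins_play L G REACH n \<pi>" if "play L G s n \<pi>" "conforms_play L G REACH T s n \<pi>" for n \<pi>
    using reach_attr_reaches_goal[OF that(1) assms(2)] play_conforming_move[OF that] by blast
  show "\<exists>y \<in> states L. holds2 L (T \<^bold>\<and> move_pred G REACH) (last xs) y"
    if xs: "play_prefix L G s xs" "conforms_list L REACH T xs" "last xs \<in> owned L REACH" for xs
  proof -
    have "reach_attr G T (last xs)"
      using xs(1,2) assms(2) by (rule conforming_prefix_induct) (auto elim: reach_attr.cases)
    moreover have "\<not> holds L (Goal G) (last xs)"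
      using xs(1) by (simp add: play_prefix_def)
    ultimately show ?thesis
      using strat_move_witness[OF assms(1) xs(3)] by (auto elim!: reach_attr.cases)
  qed
qed

lemma reach_attr_wins_from:
  assumes "reachability_game L G" "reach_attr G T s"
  shows "wins_from L G REACH s"
proof -
  \<comment> \<open>A positional strategy chosen from \<open>T\<close>. The fallbacks, any legal
    move and finally \<open>x\<close> itself in a trap, are there because a strategy must be legal
    after every history.\<close>
  define \<sigma> where "\<sigma> w = (let x = last w in
    if \<exists>y. strat_move G REACH T x y then SOME y. strat_move G REACH T x y
    else if \<exists>y. move G x y then SOME y. move G x y else x)" for w
  have \<sigma>_strat: "strat_move G REACH T (last w) (\<sigma> w)" if "\<exists>y. strat_move G REACH T (last w) y" for w
    using that by (simp add: \<sigma>_def someI_ex)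
  have \<sigma>_move: "move G (last w) (\<sigma> w)" if "\<exists>y. move G (last w) y" for w
    using that \<sigma>_strat[of w] strat_move_move
    by (cases "\<exists>y. strat_move G REACH T (last w) y") (auto simp: \<sigma>_def Let_def intro: someI[of "move G _"])
  have "strategy L G REACH \<sigma>"
    unfolding strategy_def
  proof (intro allI impI; elim conjE)
    fix w x
    assume x: "x \<in> owned L REACH"
    have "\<sigma> (w @ [x]) \<in> states L"
    proof (cases "\<exists>y. move G x y")
      case True
      then show ?thesis
        using \<sigma>_move[of "w @ [x]"] move_states by auto
    next
      case False
      then have "\<sigma> (w @ [x]) = x"
        by (auto simp: \<sigma>_def strat_move_def)
      then show ?thesis
        using x owned_states by auto
    qed
    then show "\<sigma> (w @ [x]) \<in> states L \<and>
        (\<not> trap L G x \<longrightarrow> holds2 L (move_pred G REACH) x (\<sigma> (w @ [x])))"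
      using x \<sigma>_move[of "w @ [x]"] assms(1) owned_states[OF x]
      by (auto simp: trap_iff move_pred_iff simp del: owned.simps move_pred.simps)
  qed
  moreover have "wins_play L G REACH n \<pi>" if "play L G s n \<pi>" "consistent L REACH \<sigma> n \<pi>" for n \<pi>
    using that(1) assms(2)
  proof (rule reach_attr_reaches_goal)
    fix i
    assume i: "enat (Suc i) < n" and ex: "\<exists>y. strat_move G REACH T (\<pi> i) y"
    show "strat_move G REACH T (\<pi> i) (\<pi> (Suc i))"
    proof (cases "\<pi> i \<in> owned L REACH")
      case True
      then have "\<pi> (Suc i) = \<sigma> (map \<pi> [0..<Suc i])"
        using that(2) i by (auto simp: consistent_def simp del: owned.simps)
      then show ?thesis
        using \<sigma>_strat[of "map \<pi> [0..<Suc i]"] ex by simp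
    next
      case False
      then show ?thesis
        using play_move[OF that(1) i] by (simp add: strat_move_def del: owned.simps)
    qed
  qed
  ultimately show ?thesis
    unfolding wins_from_def by blast
qed

section \<open>Invariant states are won by SAFE and not by REACH\<close>

lemma safe_inv_avoids_goal:
  assumes play: "play L G s n \<pi>" and "safe_inv G T s"
    and strat: "\<And>i. \<lbrakk>enat (Suc i) < n; \<forall>j \<le> i. safe_inv G T (\<pi> j)\<rbrakk>
      \<Longrightarrow> strat_move G SAFE T (\<pi> i) (\<pi> (Suc i))"
  shows "wins_play L G SAFE n \<pi>"
proof -
  \<comment> \<open>The claim covers all earlier positions because \<open>strat\<close> may rely on
    the whole history lying in the invariant; conformance needs that history to be
    goal-free.\<close>
  have inv: "enat i < n \<Longrightarrow> \<forall>j \<le> i. safe_inv G T (\<pi> j)" for i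
  proof (induction i)
    case 0
    then show ?case
      using assms by (simp add: play_def)
  next
    case (Suc i)
    then have "\<forall>j \<le> i. safe_inv G T (\<pi> j)"
      using Suc_ile_eq order_le_less by blast
    then show ?case
      using strat[OF Suc.prems] by (metis le_Suc_eq order_refl safe_inv_next)
  qed
  have "\<not> holds L (Goal G) (\<pi> i)" if "enat i < n" for i
    using inv[OF that] safe_inv_not_goal by blast
  then show ?thesis
    by simp
qed

lemma safe_inv_symbolic_winning:
  assumes "reachability_game L G" "safe_inv G T s"
  shows "symbolic_winning L G SAFE T s"
  unfolding symbolic_winning_def
proof (intro conjI allI impI; elim conjE)
  show "wins_play L G SAFE n \<pi>" if "play L G s n \<pi>" "conforms_play L G SAFE T s n \<pi>" for n \<pi>
    using safe_inv_avoids_goal[OF that(1) assms(2)] play_conforming_move[OF that] safe_inv_not_goal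
    by blast
  show "\<exists>y \<in> states L. holds2 L (T \<^bold>\<and> move_pred G SAFE) (last xs) y"
    if xs: "play_prefix L G s xs" "conforms_list L SAFE T xs" "last xs \<in> owned L SAFE" for xs
  proof -
    have "safe_inv G T (last xs)"
      using xs(1,2) assms(2) by (rule conforming_prefix_induct) (rule safe_inv_next)
    moreover have "\<exists>y. move G (last xs) y"
      using xs(1) owned_states[OF xs(3)] by (simp add: play_prefix_def trap_iff)
    ultimately show ?thesis
      using strat_move_witness[OF assms(1) xs(3)] safe_inv_ex by blast
  qed
qed

lemma play_generated_by:
  assumes "s \<in> states L"
    and next_move: "\<And>w. \<lbrakk>w \<noteq> []; set w \<subseteq> states L; \<exists>y. move G (last w) y\<rbrakk> \<Longrightarrow> move G (last w) (f w)"
  obtains n \<pi> where "play L G s n \<pi>"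
    and "\<And>i. enat (Suc i) < n \<Longrightarrow> \<pi> (Suc i) = f (map \<pi> [0..<Suc i])"
proof -
  \<comment> \<open>The recursion runs on histories, since \<open>f\<close> reads the whole history
    and not only the last state.\<close>
  define h where "h = rec_nat [s] (\<lambda>_ w. w @ [f w])"
  define \<pi> where "\<pi> i = last (h i)" for i
  have h: "h 0 = [s]" "h (Suc i) = h i @ [f (h i)]" for i
    by (simp_all add: h_def)
  have h_eq: "h i = map \<pi> [0..<Suc i]" for i
    by (induction i) (auto simp: h \<pi>_def)
  have \<pi>: "\<pi> 0 = s" "\<pi> (Suc i) = f (map \<pi> [0..<Suc i])" for i
    by (simp add: \<pi>_def h, simp only: \<pi>_def h last_snoc flip: h_eq)
  \<comment> \<open>The play is cut at its first trap. \<open>Suc\<close> makes the length include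
    the trap itself.\<close>
  define n where "n = (if \<exists>k. trap L G (\<pi> k) then enat (Suc (LEAST k. trap L G (\<pi> k))) else \<infinity>)"
  have no_trap: "\<not> trap L G (\<pi> i)" if "enat (Suc i) < n" for i
    using that not_less_Least[of i "\<lambda>k. trap L G (\<pi> k)"] by (auto simp: n_def split: if_splits)
  have states: "enat i < n \<Longrightarrow> \<forall>j \<le> i. \<pi> j \<in> states L" for i
  proof (induction i)
    case 0
    then show ?case
      using assms(1) \<pi> by simp
  next
    case (Suc i)
    then have IH: "\<forall>j \<le> i. \<pi> j \<in> states L"
      using Suc_ile_eq order_le_less by blast
    then have "move G (\<pi> i) (\<pi> (Suc i))"
      using next_move[of "map \<pi> [0..<Suc i]"] no_trap[OF Suc.prems]
      by (auto simp: trap_iff \<pi> image_subset_iff)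
    then show ?case
      using IH by (auto simp: le_Suc_eq dest: move_states)
  qed
  have move: "move G (\<pi> i) (\<pi> (Suc i))" if "enat (Suc i) < n" for i
    using next_move[of "map \<pi> [0..<Suc i]"] no_trap[OF that] states[OF that]
    by (auto simp: trap_iff \<pi> le_Suc_eq image_subset_iff)
  have "play L G s n \<pi>"
    unfolding play_def
  proof (intro conjI allI impI)
    show "0 < n"
      by (simp add: n_def enat_0_iff)
    show "\<pi> i \<in> states L" if "enat i < n" for i
      using states[OF that] by simp
    show "holds2 L (Safe G) (\<pi> i) (\<pi> (Suc i)) \<or> holds2 L (Reach G) (\<pi> i) (\<pi> (Suc i))"
      if "enat (Suc i) < n" for i
      using move[OF that] by (auto simp: move_def holds2_simps)
    show "trap L G (\<pi> k)" if "n = enat (Suc k)" for k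
      using that by (auto simp: n_def intro: LeastI split: if_splits)
  qed (rule \<pi>)
  then show thesis
    using that \<pi>(2) by blast
qed

text \<open>Against any strategy \<open>\<sigma>\<close> of REACH, let SAFE follow \<open>T\<close>.
  The resulting play is consistent with \<open>\<sigma>\<close> and never leaves the invariant, so
  both players would win it.\<close>

lemma safe_inv_not_wins_from:
  assumes "reachability_game L G" "s \<in> states L" "safe_inv G T s"
  shows "\<not> wins_from L G REACH s"
proof
  assume "wins_from L G REACH s"
  then obtain \<sigma> where \<sigma>: "strategy L G REACH \<sigma>"
    and win: "\<And>n \<pi>. \<lbrakk>play L G s n \<pi>; consistent L REACH \<sigma> n \<pi>\<rbrakk> \<Longrightarrow> wins_play L G REACH n \<pi>"
    unfolding wins_from_def by blast
  define f where "f w = (let x = last w in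
    if x \<in> owned L REACH then \<sigma> w
    else if \<exists>y. strat_move G SAFE T x y then SOME y. strat_move G SAFE T x y
    else SOME y. move G x y)" for w
  have f_strat: "strat_move G SAFE T (last w) (f w)"
    if "last w \<notin> owned L REACH" "\<exists>y. strat_move G SAFE T (last w) y" for w
    using that by (simp add: f_def someI_ex del: owned.simps)
  have f_move: "move G (last w) (f w)" if w: "w \<noteq> []" "set w \<subseteq> states L" "\<exists>y. move G (last w) y" for w
  proof (cases "last w \<in> owned L REACH")
    case True
    have "set (butlast w) \<subseteq> states L"
      using w(2) by (meson in_set_butlastD subset_iff)
    then have "\<sigma> w \<in> states L \<and> holds2 L (move_pred G REACH) (last w) (\<sigma> w)"
      using \<sigma> True w trap_iff[OF owned_states[OF True]] unfolding strategy_def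
      by (metis append_butlast_last_id)
    then show ?thesis
      using True move_pred_iff[OF assms(1) True] by (auto simp: f_def simp del: owned.simps move_pred.simps)
  next
    case False
    then show ?thesis
      using f_strat[of w] strat_move_move w(3)
      by (cases "\<exists>y. strat_move G SAFE T (last w) y") (auto simp: f_def Let_def intro: someI[of "move G _"] simp del: owned.simps)
  qed
  obtain n \<pi> where play: "play L G s n \<pi>"
    and next_eq: "\<And>i. enat (Suc i) < n \<Longrightarrow> \<pi> (Suc i) = f (map \<pi> [0..<Suc i])"
    using play_generated_by[OF assms(2) f_move] by metis
  have "consistent L REACH \<sigma> n \<pi>"
    using next_eq by (auto simp: consistent_def f_def simp del: owned.simps)
  then have "wins_play L G REACH n \<pi>"
    using win play by blast
  moreover have "wins_play L G SAFE n \<pi>"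
    using play assms(3)
  proof (rule safe_inv_avoids_goal)
    fix i
    assume i: "enat (Suc i) < n" and inv: "\<forall>j \<le> i. safe_inv G T (\<pi> j)"
    have m: "move G (\<pi> i) (\<pi> (Suc i))"
      using play i by (rule play_move)
    show "strat_move G SAFE T (\<pi> i) (\<pi> (Suc i))"
    proof (cases "\<pi> i \<in> owned L REACH")
      case True
      then show ?thesis
        using m by (simp add: strat_move_def)
    next
      case False
      have "\<exists>y. strat_move G SAFE T (\<pi> i) y"
        using inv m safe_inv_ex by blast
      then show ?thesis
        using f_strat[of "map \<pi> [0..<Suc i]"] False next_eq[OF i] by simp
    qed
  qed
  ultimately show False
    by simp
qed


section \<open>The subgames of the procedure\<close>

lemma move_post_game:
  assumes "state_pred L \<phi>"
  shows "move (post_game L \<phi> C G) x y \<longleftrightarrow> move G x y \<and> holds L \<phi> x"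
  using assms by (auto simp: move_def post_game_def holds2_simps holds2_state_pred)

lemma move_pre_game: "move (pre_game L I F G) x y \<longleftrightarrow> move G x y \<and> \<not> holds2 L F x y"
  by (auto simp: move_def pre_game_def holds2_simps)

text \<open>The semantic content of \<open>Pre (Enf T G)\<close>: REACH can force the next
  transition to be in \<open>T\<close>, either by owning \<open>x\<close> or because SAFE has no
  alternative.\<close>

definition enforceable :: "'f \<Rightarrow> 'f game \<Rightarrow> ('v \<Rightarrow> 'd) \<Rightarrow> bool" where
  "enforceable T G x \<longleftrightarrow> (\<exists>y. move G x y \<and> holds2 L T x y) \<and>
    (x \<in> owned L SAFE \<longrightarrow> (\<forall>y. move G x y \<longrightarrow> holds2 L T x y))"

text \<open>\<open>Safe\<close> transitions are exactly the moves out of states of SAFE, so the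
  negated quantifier in \<open>Enf\<close> constrains these states only.\<close>

lemma holds2_Enf:
  assumes "reachability_game L G" "x \<in> states L" "y \<in> states L"
  shows "holds2 L (Enf L T G) x y \<longleftrightarrow> move G x y \<and> holds2 L T x y \<and> enforceable T G x"
proof -
  have "holds2 L (Safe G) x z \<longleftrightarrow> move G x z \<and> x \<in> owned L SAFE" if z: "z \<in> states L" for z
  proof (cases "x \<in> owned L SAFE")
    case True
    then show ?thesis
      using move_pred_iff[OF assms(1) True z] by simp
  next
    case False
    then show ?thesis
      using assms(1,2) z
      by (auto simp: reachability_game_def valid_iff holds2_simps owned_SAFE_iff simp del: owned.simps)
  qed
  then have "(\<exists>z \<in> states L. holds2 L (Safe G) x z \<and> \<not> holds2 L T x z) \<longleftrightarrow>
      x \<in> owned L SAFE \<and> (\<exists>z. move G x z \<and> \<not> holds2 L T x z)"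
    using move_states by blast
  moreover have "holds2 L (Enf L T G) x y \<longleftrightarrow> move G x y \<and> holds2 L T x y \<and>
      \<not> (\<exists>z \<in> states L. holds2 L (Safe G) x z \<and> \<not> holds2 L T x z)"
    using assms(2,3) by (simp add: Enf_def holds2_simps move_def)
  ultimately show ?thesis
    unfolding enforceable_def by blast
qed

lemma satisfiable_Enf_iff:
  assumes "reachability_game L G"
  shows "satisfiable L (Enf L T G) \<longleftrightarrow> (\<exists>x. enforceable T G x)"
  using holds2_Enf[OF assms] move_states unfolding satisfiable_iff enforceable_def by blast

lemma holds_goal_pre_game:
  assumes "reachability_game L G" "x \<in> states L"
  shows "holds L (Goal (pre_game L I F G)) x \<longleftrightarrow> enforceable F G x"
  using holds2_Enf[OF assms] move_states assms(2)
  by (auto simp: pre_game_def holds_def Pre_def holds2_simps enforceable_def)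

lemma not_enforceable_move:
  assumes "\<not> enforceable T G x" "move G x y" "x \<in> owned L REACH"
  shows "\<not> holds2 L T x y"
  using assms by (auto simp: enforceable_def)

lemma not_enforceable_ex_move:
  assumes "\<not> enforceable T G x" "move G x y"
  obtains z where "move G x z" "\<not> holds2 L T x z"
  using assms by (auto simp: enforceable_def)

lemma reachability_game_post_game:
  assumes "reachability_game L G"
  shows "reachability_game L (post_game L \<phi> C G)"
  using assms
  by (auto simp: reachability_game_def post_game_def valid_iff holds2_simps state_pred_unprime simp del: owned.simps)

lemma reachability_game_pre_game:
  assumes "reachability_game L G" "state_pred L I"
  shows "reachability_game L (pre_game L I F G)"
  using assms
  by (auto simp: reachability_game_def pre_game_def valid_iff holds2_simps state_pred_Pre simp del: owned.simps)

section \<open>Combined strategies and the transfer of attractors from the subgames\<close>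

lemma symbolic_strategy_iff:
  "symbolic_strategy L G T \<longleftrightarrow> (\<forall>x \<in> states L. \<forall>y \<in> states L. holds2 L T x y \<longrightarrow> move G x y)"
  by (auto simp: symbolic_strategy_def valid_iff holds2_simps move_def)

lemma holds2_combine:
  assumes "x \<in> states L" "y \<in> states L"
  shows "holds2 L (combine L A F B) x y \<longleftrightarrow>
    (if \<exists>z \<in> states L. holds2 L B x z then holds2 L B x y
     else if \<exists>z \<in> states L. holds2 L F x z then holds2 L F x y
     else holds2 L A x y)"
  using assms by (auto simp: combine_def Pre_def holds2_simps)

text \<open>A move of the post game starts in \<open>\<phi>\<close>, where both games have the same
  moves. If REACH owns the state, \<open>B\<close> has a move there and \<open>combine\<close>
  selects \<open>B\<close>; hence the strategy moves of the two games coincide.\<close>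

lemma reach_attr_post_game:
  assumes \<phi>: "state_pred L \<phi>" and B: "symbolic_strategy L (post_game L \<phi> C G) B"
    and "reach_attr (post_game L \<phi> C G) B x"
  shows "reach_attr G (combine L A F B) x"
  using assms(3)
proof (induction rule: reach_attr.induct)
  case (goal x)
  then show ?case
    by (auto simp: post_game_def intro: reach_attr.goal)
next
  case (step x z)
  have z: "move G x z" "holds L \<phi> x"
    using step.hyps(1) \<phi> by (auto simp: strat_move_def move_post_game)
  have B_z: "x \<in> owned L REACH \<Longrightarrow> holds2 L B x z"
    using step.hyps(1) by (simp add: strat_move_def)
  have "strat_move (post_game L \<phi> C G) REACH B x y \<longleftrightarrow> strat_move G REACH (combine L A F B) x y" for y
    using z B_z \<phi> move_states[of G x y] move_states[OF z(1)]
    by (auto simp: strat_move_def move_post_game holds2_combine simp del: owned.simps split: if_splits)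
  then show ?case
    using step reach_attr.step by metis
qed

text \<open>Follow the attraction in the pre game. Where \<open>combine\<close> overrides
  \<open>A\<close>, by \<open>B\<close> or by \<open>F\<close>, the state is attracted anyway; the
  transitions in \<open>F\<close> that the pre game lacks end in attracted states.\<close>

lemma reach_attr_pre_game:
  assumes G: "reachability_game L G"
    and B_attr: "\<And>x y. \<lbrakk>x \<in> owned L REACH; y \<in> states L; holds2 L B x y\<rbrakk> \<Longrightarrow> reach_attr G (combine L A F B) x"
    and F_attr: "\<And>x y. \<lbrakk>move G x y; holds2 L F x y\<rbrakk> \<Longrightarrow> reach_attr G (combine L A F B) y"
    and F_move: "\<And>x y. \<lbrakk>x \<in> states L; y \<in> states L; holds2 L F x y\<rbrakk> \<Longrightarrow> move G x y"
    and "reach_attr (pre_game L I F G) A x" "x \<in> states L"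
  shows "reach_attr G (combine L A F B) x"
proof -
  let ?T = "combine L A F B"
  have B_case: "reach_attr G ?T x" if "x \<in> owned L REACH" "\<exists>z \<in> states L. holds2 L B x z" for x
    using that B_attr by blast
  show ?thesis
    using assms(5,6)
  proof (induction rule: reach_attr.induct)
    case (goal x)
    then have enf: "enforceable F G x"
      using holds_goal_pre_game[OF G] by blast
    then obtain z where z: "move G x z" "holds2 L F x z"
      by (auto simp: enforceable_def)
    show ?case
    proof (cases "x \<in> owned L REACH \<and> (\<exists>z \<in> states L. holds2 L B x z)")
      case True
      then show ?thesis
        using B_case by blast
    next
      case False
      have "strat_move G REACH ?T x z"
        using z False move_states[OF z(1)] by (auto simp: strat_move_def holds2_combine simp del: owned.simps)
      moreover have "reach_attr G ?T y" if y: "strat_move G REACH ?T x y" for y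
      proof -
        \<comment> \<open>In a state of REACH \<open>combine\<close> selects \<open>F\<close>; in a
          state of SAFE enforceability puts every move in \<open>F\<close>.\<close>
        have "holds2 L F x y"
          using y z False enf move_states[OF z(1)] move_states[OF strat_move_move[OF y]]
          by (cases "x \<in> owned L REACH")
            (auto simp: strat_move_def holds2_combine enforceable_def owned_SAFE_iff
              simp del: owned.simps split: if_splits)
        then show ?thesis
          using F_attr y strat_move_move by blast
      qed
      ultimately show ?thesis
        by (rule reach_attr.step)
    qed
  next
    case (step x z)
    have z: "move G x z" "\<not> holds2 L F x z" "x \<in> owned L REACH \<Longrightarrow> holds2 L A x z"
      using step.hyps(1) by (auto simp: strat_move_def move_pre_game)
    show ?case
    proof (cases "x \<in> owned L REACH \<and> ((\<exists>z \<in> states L. holds2 L B x z) \<or> (\<exists>z \<in> states L. holds2 L F x z))")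
      case True
      then consider "x \<in> owned L REACH" "\<exists>z \<in> states L. holds2 L B x z"
        | u where "x \<in> owned L REACH" "u \<in> states L" "holds2 L F x u" "\<not> (\<exists>z \<in> states L. holds2 L B x z)"
        by blast
      then show ?thesis
      proof cases
        case 1
        then show ?thesis
          by (rule B_case)
      next
        case 2
        then have T: "holds2 L ?T x y \<longleftrightarrow> holds2 L F x y" if "y \<in> states L" for y
          using that step.prems by (auto simp: holds2_combine)
        have u: "strat_move G REACH ?T x u"
          using 2 T F_move step.prems by (simp add: strat_move_def del: owned.simps)
        show ?thesis
          using u
        proof (rule reach_attr.step)
          fix y
          assume y: "strat_move G REACH ?T x y"
          then show "reach_attr G ?T y"
            using F_attr[of x y] T[of y] 2(1) move_states[of G x y] by (auto simp: strat_move_def simp del: owned.simps)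
        qed
      qed
    next
      case False
      have "strat_move G REACH ?T x z"
        using z False move_states[OF z(1)] by (auto simp: strat_move_def holds2_combine simp del: owned.simps)
      then show ?thesis
      proof (rule reach_attr.step)
        fix y
        assume y: "strat_move G REACH ?T x y"
        then have m: "move G x y" "y \<in> states L"
          using strat_move_move move_states by blast+
        show "reach_attr G ?T y"
        \<comment> \<open>Only SAFE can play a move in \<open>F\<close> here, because a state of
          REACH with such a move belongs to the previous case.\<close>
        proof (cases "holds2 L F x y")
          case True
          then show ?thesis
            using F_attr m by blast
        next
          case False_F: False
          have "strat_move (pre_game L I F G) REACH A x y"
            using y m False_F False step.prems
            by (auto simp: strat_move_def move_pre_game holds2_combine simp del: owned.simps)
          then show ?thesis
            using step.IH m by blast
        qed
      qed
    qed
  qed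
qed

section \<open>Correctness of the procedure\<close>

text \<open>
  The last conjunct is what makes the induction work: \<open>combine\<close> gives precedence to the
  strategy of the post game even in states visited during the pre game that are not initial in
  the post game, so a move of a returned reachability strategy must be winning wherever it exists.
\<close>

definition correct :: "'f game \<Rightarrow> 'f \<Rightarrow> 'f \<Rightarrow> 'f \<Rightarrow> bool" where
  "correct G R SR SS \<longleftrightarrow>
    symbolic_strategy L G SR \<and> symbolic_strategy L G SS \<and>
    (\<forall>s \<in> states L. holds L R s \<longrightarrow> reach_attr G SR s) \<and>
    (\<forall>s \<in> states L. holds L (Init G) s \<and> \<not> holds L R s \<longrightarrow> safe_inv G SS s) \<and>
    (\<forall>x \<in> owned L REACH. \<forall>y \<in> states L. holds2 L SR x y \<longrightarrow> reach_attr G SR x)"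

lemma correctD:
  assumes "correct G R SR SS"
  shows "symbolic_strategy L G SR" "symbolic_strategy L G SS"
    and "\<lbrakk>s \<in> states L; holds L R s\<rbrakk> \<Longrightarrow> reach_attr G SR s"
    and "\<lbrakk>s \<in> states L; holds L (Init G) s; \<not> holds L R s\<rbrakk> \<Longrightarrow> safe_inv G SS s"
    and "\<lbrakk>x \<in> owned L REACH; y \<in> states L; holds2 L SR x y\<rbrakk> \<Longrightarrow> reach_attr G SR x"
  using assms unfolding correct_def by blast+

lemma correct_no_reach_strategy:
  assumes "symbolic_strategy L G SS"
    and "\<And>s. \<lbrakk>s \<in> states L; holds L (Init G) s; \<not> holds L (Goal G) s\<rbrakk> \<Longrightarrow> safe_inv G SS s"
  shows "correct G (Init G \<^bold>\<and> Goal G) \<^bold>\<bottom> SS"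
  using assms owned_states[of _ REACH] unfolding correct_def
  by (auto simp: symbolic_strategy_iff holds2_simps holds_simps intro: reach_attr.goal simp del: owned.simps)

section \<open>Crossing the interpolant\<close>

context
  fixes G I \<phi>
  assumes G: "reachability_game L G"
    and I_def: "I = Init G \<^bold>\<and> \<^bold>\<not> Goal G"
    and sp: "state_pred L \<phi>"
    and goal_\<phi>: "\<And>x. \<lbrakk>x \<in> states L; holds L (Goal G) x\<rbrakk> \<Longrightarrow> holds L \<phi> x"
    and I_\<phi>: "\<And>x. \<lbrakk>x \<in> states L; holds L I x\<rbrakk> \<Longrightarrow> \<not> holds L \<phi> x"
begin

private abbreviation "C \<equiv> Instantiate L \<phi> G"

lemma holds2_Instantiate:
  "\<lbrakk>x \<in> states L; y \<in> states L\<rbrakk> \<Longrightarrow> holds2 L C x y \<longleftrightarrow> move G x y \<and> \<not> holds L \<phi> x \<and> holds L \<phi> y"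
  using sp by (auto simp: Instantiate_def move_def holds2_simps holds2_state_pred)

lemma holds_I: "x \<in> states L \<Longrightarrow> holds L I x \<longleftrightarrow> holds L (Init G) x \<and> \<not> holds L (Goal G) x"
  by (simp add: I_def holds_simps)

text \<open>In a state of REACH, a single move in \<open>T\<close> would make \<open>T\<close>
  enforceable; in a state of SAFE, the strategy \<open>S\<close> itself rules \<open>T\<close>
  out.\<close>

lemma strat_move_safe_not_enforceable:
  assumes "\<not> enforceable T G x" "strat_move G SAFE S x y"
    and "x \<in> owned L SAFE \<Longrightarrow> holds2 L S x y \<Longrightarrow> \<not> holds2 L T x y"
  shows "\<not> holds2 L T x y"
proof (cases "x \<in> owned L SAFE")
  case True
  then show ?thesis
    using assms(2,3) by (simp add: strat_move_def del: owned.simps)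
next
  case False
  have "move G x y"
    using assms(2) by (rule strat_move_move)
  then show ?thesis
    using assms(1) False not_enforceable_move move_states owned_SAFE_iff by blast
qed

text \<open>The invariant is the complement of \<open>\<phi>\<close>. Leaving it takes a transition
  in \<open>C\<close>, which REACH never has where \<open>C\<close> is not enforceable and which
  SAFE can always avoid.\<close>

lemma correct_no_enforceable_subgoal:
  assumes unsat: "\<not> satisfiable L (Enf L C G)"
  shows "correct G (Init G \<^bold>\<and> Goal G) \<^bold>\<bottom> (Safe G \<^bold>\<and> \<^bold>\<not> C)"
proof (rule correct_no_reach_strategy)
  let ?S = "Safe G \<^bold>\<and> \<^bold>\<not> C"
  show "symbolic_strategy L G ?S"
    by (auto simp: symbolic_strategy_iff move_def holds2_simps)
  have not_enf: "\<not> enforceable C G x" for x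
    using unsat satisfiable_Enf_iff[OF G] by blast
  fix s
  assume s: "s \<in> states L" "holds L (Init G) s" "\<not> holds L (Goal G) s"
  show "safe_inv G ?S s"
  proof (rule safe_invI[where P = "\<lambda>x. x \<in> states L \<and> \<not> holds L \<phi> x"])
    show "s \<in> states L \<and> \<not> holds L \<phi> s"
      using s I_\<phi> holds_I by blast
    show "\<not> holds L (Goal G) x" if "x \<in> states L \<and> \<not> holds L \<phi> x" for x
      using that goal_\<phi> by blast
  next
    fix x y
    assume x: "x \<in> states L \<and> \<not> holds L \<phi> x" and y: "strat_move G SAFE ?S x y"
    have m: "move G x y" "y \<in> states L"
      using y strat_move_move move_states by blast+
    have "\<not> holds2 L C x y"
      using not_enf y by (rule strat_move_safe_not_enforceable) (use x m in \<open>simp add: holds2_simps\<close>)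
    then show "y \<in> states L \<and> \<not> holds L \<phi> y"
      using x m holds2_Instantiate by blast
  next
    fix x y
    assume x: "x \<in> states L \<and> \<not> holds L \<phi> x" and y: "move G x y"
    obtain z where "move G x z" "\<not> holds2 L C x z"
      using not_enf y by (rule not_enforceable_ex_move)
    then show "\<exists>y. strat_move G SAFE ?S x y"
      using x move_states[of G x z] move_pred_iff[OF G, of x SAFE z]
      by (intro exI[of _ z]) (auto simp: strat_move_def holds2_simps simp del: owned.simps)
  qed
qed

section \<open>After the call on the post game\<close>

context
  fixes R_post SR_post SS_post F
  assumes post: "correct (post_game L \<phi> C G) R_post SR_post SS_post"
    and F_def: "F = C \<^bold>\<and> prime L R_post"
begin

private abbreviation "G_post \<equiv> post_game L \<phi> C G"

lemma holds2_F:
  "\<lbrakk>x \<in> states L; y \<in> states L\<rbrakk> \<Longrightarrow>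
    holds2 L F x y \<longleftrightarrow> move G x y \<and> \<not> holds L \<phi> x \<and> holds L \<phi> y \<and> holds L R_post y"
  by (simp add: F_def holds2_simps holds2_Instantiate)

text \<open>Such a crossing lies in \<open>C\<close>, so \<open>y\<close> is initial in the post
  game; not being in \<open>F\<close>, it misses \<open>R_post\<close>.\<close>

lemma safe_inv_post_entry:
  assumes "move G x y" "\<not> holds L \<phi> x" "holds L \<phi> y" "\<not> holds2 L F x y"
  shows "safe_inv G_post SS_post y"
proof (rule correctD(4)[OF post])
  have xy: "x \<in> states L" "y \<in> states L"
    using assms(1) move_states by blast+
  show "y \<in> states L"
    by (rule xy)
  show "\<not> holds L R_post y"
    using assms xy holds2_F by blast
  have "holds2 L C x y"
    using assms xy holds2_Instantiate by blast
  then show "holds L (Init G_post) y"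
    using xy by (auto simp: post_game_def holds_def Post_def holds2_simps)
qed

lemma goal_post: "Goal G_post = Goal G"
  by (simp add: post_game_def)

lemma correct_no_winning_subgoal:
  assumes unsat: "\<not> satisfiable L (Enf L F G)"
  shows "correct G (Init G \<^bold>\<and> Goal G) \<^bold>\<bottom> (Safe G \<^bold>\<and> \<^bold>\<not> F \<^bold>\<and> (\<phi> \<^bold>\<longrightarrow> SS_post))"
proof (rule correct_no_reach_strategy)
  let ?S = "Safe G \<^bold>\<and> \<^bold>\<not> F \<^bold>\<and> (\<phi> \<^bold>\<longrightarrow> SS_post)"
  \<comment> \<open>A play may return from \<open>\<phi>\<close> to its complement: the post game
    stops there, so its invariant does too, while the complement belongs to \<open>?P\<close> as a
    whole.\<close>
  let ?P = "\<lambda>x. x \<in> states L \<and> (holds L \<phi> x \<longrightarrow> safe_inv G_post SS_post x)"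
  show "symbolic_strategy L G ?S"
    by (auto simp: symbolic_strategy_iff move_def holds2_simps)
  have not_enf: "\<not> enforceable F G x" for x
    using unsat satisfiable_Enf_iff[OF G] by blast
  have S_iff: "holds2 L ?S x y \<longleftrightarrow>
      holds2 L (Safe G) x y \<and> \<not> holds2 L F x y \<and> (holds L \<phi> x \<longrightarrow> holds2 L SS_post x y)"
    if "x \<in> states L" "y \<in> states L" for x y
    using that sp by (simp add: holds2_simps holds2_state_pred)
  \<comment> \<open>Transitions in \<open>F\<close> start outside \<open>\<phi>\<close>, so the
    conjunct excluding \<open>F\<close> is void at \<open>x\<close>.\<close>
  have S_post: "strat_move G SAFE ?S x y \<longleftrightarrow> strat_move G_post SAFE SS_post x y"
    if x: "x \<in> states L" "holds L \<phi> x" for x y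
  proof -
    have "move G x y \<Longrightarrow> y \<in> states L"
      using move_states by blast
    then show ?thesis
      using x S_iff[of x y] holds2_F[of x y] move_pred_iff[OF G, of x SAFE y]
      by (auto simp: strat_move_def move_post_game[OF sp] simp del: owned.simps)
  qed
  fix s
  assume s: "s \<in> states L" "holds L (Init G) s" "\<not> holds L (Goal G) s"
  show "safe_inv G ?S s"
  proof (rule safe_invI[where P = ?P])
    show "?P s"
      using s I_\<phi> holds_I by blast
    show "\<not> holds L (Goal G) x" if "?P x" for x
      using that goal_\<phi> safe_inv_not_goal goal_post by metis
  next
    fix x y
    assume x: "?P x" and y: "strat_move G SAFE ?S x y"
    have m: "move G x y" "y \<in> states L"
      using y strat_move_move move_states by blast+
    show "?P y"
    proof (cases "holds L \<phi> x")
      case True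
      then show ?thesis
        using x y m S_post safe_inv_next by blast
    next
      case False
      have "\<not> holds2 L F x y"
        using not_enf y by (rule strat_move_safe_not_enforceable) (use x m S_iff in blast)
      then show ?thesis
        using m False safe_inv_post_entry by blast
    qed
  next
    fix x y
    assume x: "?P x" and y: "move G x y"
    show "\<exists>y. strat_move G SAFE ?S x y"
    proof (cases "holds L \<phi> x")
      case True
      then have "move G_post x y"
        using y move_post_game[OF sp] by blast
      then show ?thesis
        using x True S_post safe_inv_ex by blast
    next
      case False
      obtain z where z: "move G x z" "\<not> holds2 L F x z"
        using not_enf y by (rule not_enforceable_ex_move)
      then show ?thesis
        using x False move_states[of G x z] move_pred_iff[OF G, of x SAFE z] S_iff[of x z]
        by (intro exI[of _ z]) (auto simp: strat_move_def simp del: owned.simps)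
    qed
  qed
qed

section \<open>After the call on the pre game\<close>

context
  fixes F' \<phi>' R_pre SR_pre SS_pre
  assumes F'_def: "(F', \<phi>') =
        (if satisfiable L ((Reach G \<^bold>\<or> Safe G) \<^bold>\<and> \<phi> \<^bold>\<and> \<^bold>\<not> prime L \<phi> \<^bold>\<and> \<^bold>\<not> Goal G)
         then (F \<^bold>\<or> (Safe G \<^bold>\<or> Reach G) \<^bold>\<and> prime L (Goal G), \<^bold>\<bottom>)
         else (F, \<phi>))"
    and pre: "correct (pre_game L I F' G) R_pre SR_pre SS_pre"
begin

private abbreviation "G_pre \<equiv> pre_game L I F' G"
private abbreviation "SR \<equiv> combine L SR_pre F' SR_post"
private abbreviation "SS \<equiv> (\<^bold>\<not> \<phi>' \<^bold>\<longrightarrow> SS_pre) \<^bold>\<and> (\<phi>' \<^bold>\<longrightarrow> SS_post)"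

lemma F'_cases:
  obtains (leave) "F' = F \<^bold>\<or> (Safe G \<^bold>\<or> Reach G) \<^bold>\<and> prime L (Goal G)" "\<phi>' = \<^bold>\<bottom>"
  | (stay) "F' = F" "\<phi>' = \<phi>" "\<And>x y. \<lbrakk>move G x y; holds L \<phi> x; \<not> holds L (Goal G) x\<rbrakk> \<Longrightarrow> holds L \<phi> y"
proof (cases "satisfiable L ((Reach G \<^bold>\<or> Safe G) \<^bold>\<and> \<phi> \<^bold>\<and> \<^bold>\<not> prime L \<phi> \<^bold>\<and> \<^bold>\<not> Goal G)")
  case True
  then show thesis
    using F'_def leave by simp
next
  case False
  have "state_pred L (Goal G)"
    using G by (simp add: reachability_game_def)
  then have "holds L \<phi> y" if "move G x y" "holds L \<phi> x" "\<not> holds L (Goal G) x" for x y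
    using False that sp
    by (auto simp: satisfiable_iff holds2_simps holds2_state_pred move_def) blast+
  then show thesis
    using F'_def False stay by simp
qed

lemma holds2_F'D:
  assumes "x \<in> states L" "y \<in> states L" "holds2 L F' x y"
  shows "move G x y \<and> (holds L R_post y \<or> holds L (Goal G) y)"
proof (cases rule: F'_cases)
  case leave
  then show ?thesis
    using assms holds2_F[OF assms(1,2)] by (auto simp: holds2_simps move_def)
next
  case stay
  then show ?thesis
    using assms holds2_F by blast
qed

lemma reach_attr_F':
  assumes "move G x y" "holds2 L F' x y"
  shows "reach_attr G SR y"
proof -
  have xy: "x \<in> states L" "y \<in> states L"
    using assms(1) move_states by blast+
  then consider "holds L R_post y" | "holds L (Goal G) y"
    using holds2_F'D assms(2) by blast
  then show ?thesis
  proof cases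
    case 1
    show ?thesis
      using sp correctD(1)[OF post] correctD(3)[OF post xy(2) 1] by (rule reach_attr_post_game)
  next
    case 2
    then show ?thesis
      by (rule reach_attr.goal)
  qed
qed

text \<open>Applies the last conjunct of \<open>correct\<close>: \<open>x\<close> may be met during
  the pre game without being initial in the post game.\<close>

lemma reach_attr_SR_post:
  assumes "x \<in> owned L REACH" "y \<in> states L" "holds2 L SR_post x y"
  shows "reach_attr G SR x"
  using sp correctD(1)[OF post] correctD(5)[OF post assms] by (rule reach_attr_post_game)

lemma reach_attr_pre:
  assumes "reach_attr G_pre SR_pre x" "x \<in> states L"
  shows "reach_attr G SR x"
  using holds2_F'D by (intro reach_attr_pre_game[OF G reach_attr_SR_post reach_attr_F' _ assms]) blast+

text \<open>Restores the last conjunct of \<open>correct\<close> for the combined strategy, by cases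
  on the component that \<open>combine\<close> selects at \<open>x\<close>.\<close>

lemma reach_attr_SR:
  assumes "x \<in> owned L REACH" "y \<in> states L" "holds2 L SR x y"
  shows "reach_attr G SR x"
proof -
  have x: "x \<in> states L"
    using assms(1) by (rule owned_states)
  consider z where "z \<in> states L" "holds2 L SR_post x z"
    | z where "z \<in> states L" "holds2 L F' x z" "\<not> (\<exists>z \<in> states L. holds2 L SR_post x z)"
    | "holds2 L SR_pre x y"
    using assms x by (auto simp: holds2_combine split: if_splits simp del: owned.simps)
  then show ?thesis
  proof cases
    case 1
    then show ?thesis
      using assms(1) reach_attr_SR_post by blast
  next
    case 2
    then have SR: "holds2 L SR x u \<longleftrightarrow> holds2 L F' x u" if "u \<in> states L" for u
      using that x by (auto simp: holds2_combine)
    have "strat_move G REACH SR x z"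
      using 2 SR x holds2_F'D by (simp add: strat_move_def del: owned.simps)
    then show ?thesis
    proof (rule reach_attr.step)
      fix u
      assume u: "strat_move G REACH SR x u"
      then have "move G x u" "u \<in> states L"
        using strat_move_move move_states by blast+
      then show "reach_attr G SR u"
        using u assms(1) SR reach_attr_F' by (auto simp: strat_move_def simp del: owned.simps)
    qed
  next
    case 3
    then show ?thesis
      using correctD(5)[OF pre] assms(1,2) x reach_attr_pre by blast
  qed
qed

lemma symbolic_strategy_SR: "symbolic_strategy L G SR"
  unfolding symbolic_strategy_iff
proof (intro ballI impI)
  fix x y
  assume xy: "x \<in> states L" "y \<in> states L" and "holds2 L SR x y"
  then consider "holds2 L SR_post x y" | "holds2 L F' x y" | "holds2 L SR_pre x y"
    by (auto simp: holds2_combine split: if_splits)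
  then show "move G x y"
    using xy correctD(1)[OF post] correctD(1)[OF pre] holds2_F'D
    by cases (auto simp: symbolic_strategy_iff move_post_game[OF sp] move_pre_game)
qed

lemma symbolic_strategy_SS: "symbolic_strategy L G SS"
  using correctD(2)[OF post] correctD(2)[OF pre]
  by (auto simp: symbolic_strategy_iff move_post_game[OF sp] move_pre_game holds2_simps)

text \<open>A state of the invariant is not a goal of the pre game, so \<open>F'\<close> is not
  enforceable there: REACH has no move in \<open>F'\<close>, and \<open>SS_pre\<close> contains
  none. All moves under \<open>S\<close> are thus moves of the pre game.\<close>

lemma pre_step:
  assumes "safe_inv G_pre SS_pre x" "x \<in> states L"
    and S: "\<And>y. \<lbrakk>x \<in> owned L SAFE; y \<in> states L\<rbrakk> \<Longrightarrow> holds2 L S x y \<longleftrightarrow> holds2 L SS_pre x y"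
  shows "strat_move G SAFE S x y \<Longrightarrow> safe_inv G_pre SS_pre y \<and> \<not> holds2 L F' x y"
    and "move G x y \<Longrightarrow> \<exists>y. strat_move G SAFE S x y"
proof -
  have not_enf: "\<not> enforceable F' G x"
    using safe_inv_not_goal[OF assms(1)] holds_goal_pre_game[OF G assms(2)] by blast
  have SS_pre: "\<not> holds2 L F' x y" if "y \<in> states L" "holds2 L SS_pre x y" for y
    using correctD(2)[OF pre] assms(2) that by (auto simp: symbolic_strategy_iff move_pre_game)
  show "safe_inv G_pre SS_pre y \<and> \<not> holds2 L F' x y" if y: "strat_move G SAFE S x y"
  proof -
    have m: "move G x y" "y \<in> states L"
      using y strat_move_move move_states by blast+
    have F': "\<not> holds2 L F' x y"
      using not_enf y by (rule strat_move_safe_not_enforceable) (use S SS_pre m in blast)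
    have "strat_move G_pre SAFE SS_pre x y"
      using y F' S m by (auto simp: strat_move_def move_pre_game simp del: owned.simps)
    then show ?thesis
      using assms(1) F' safe_inv_next by blast
  qed
  show "\<exists>y. strat_move G SAFE S x y" if y: "move G x y"
  proof -
    obtain z where "move G x z" "\<not> holds2 L F' x z"
      using not_enf y by (rule not_enforceable_ex_move)
    \<comment> \<open>So \<open>x\<close> is no trap of the pre game, and the invariant supplies a
      strategy move.\<close>
    then have "move G_pre x z"
      by (simp add: move_pre_game)
    then obtain u where "strat_move G_pre SAFE SS_pre x u"
      using assms(1) safe_inv_ex by blast
    then have "strat_move G SAFE S x u"
      using S move_states[of G x u] by (auto simp: strat_move_def move_pre_game simp del: owned.simps)
    then show ?thesis
      by blast
  qed
qed

lemma safe_inv_SS: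
  assumes "s \<in> states L" "holds L I s" "\<not> holds L R_pre s"
  shows "safe_inv G SS s"
proof -
  have s: "safe_inv G_pre SS_pre s"
    using assms by (intro correctD(4)[OF pre]) (auto simp: pre_game_def)
  show ?thesis
  proof (cases rule: F'_cases)
    case leave
    have S: "holds2 L SS x y \<longleftrightarrow> holds2 L SS_pre x y" if "x \<in> states L" "y \<in> states L" for x y
      using that leave by (simp add: holds2_simps)
    \<comment> \<open>The pre game has a goal of its own, so the states of \<open>Goal G\<close> are
      excluded separately.\<close>
    let ?P = "\<lambda>x. x \<in> states L \<and> \<not> holds L (Goal G) x \<and> safe_inv G_pre SS_pre x"
    show ?thesis
    proof (rule safe_invI[where P = ?P])
      show "?P s"
        using assms s holds_I by blast
    next
      fix x y
      assume x: "?P x" and y: "strat_move G SAFE SS x y"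
      have m: "move G x y" "y \<in> states L"
        using y strat_move_move move_states by blast+
      have "safe_inv G_pre SS_pre y \<and> \<not> holds2 L F' x y"
        using pre_step(1)[of x SS y] S x y by blast
      \<comment> \<open>A legal move into \<open>Goal G\<close> belongs to \<open>F'\<close> in this
        case, so \<open>y\<close> is no goal.\<close>
      then show "?P y"
        using m x leave by (auto simp: holds2_simps move_def)
    next
      show "\<exists>y. strat_move G SAFE SS x y" if "?P x" "move G x y" for x y
        using pre_step(2)[of x SS y] S that by blast
    qed blast
  next
    case stay
    have S: "holds2 L SS x y \<longleftrightarrow> holds2 L (if holds L \<phi> x then SS_post else SS_pre) x y"
      if "x \<in> states L" "y \<in> states L" for x y
      using that stay sp by (simp add: holds2_simps holds2_state_pred)
    let ?P = "\<lambda>x. x \<in> states L \<and> (if holds L \<phi> x then safe_inv G_post SS_post x else safe_inv G_pre SS_pre x)"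
    show ?thesis
    proof (rule safe_invI[where P = ?P])
      show "?P s"
        using assms s I_\<phi> by simp
      show "\<not> holds L (Goal G) x" if "?P x" for x
        using that goal_\<phi> safe_inv_not_goal goal_post by metis
    next
      fix x y
      assume x: "?P x" and y: "strat_move G SAFE SS x y"
      have m: "move G x y" "y \<in> states L"
        using y strat_move_move move_states by blast+
      show "?P y"
      proof (cases "holds L \<phi> x")
        case True
        then have "strat_move G_post SAFE SS_post x y"
          using x y m S by (auto simp: strat_move_def move_post_game[OF sp] simp del: owned.simps)
        then have "safe_inv G_post SS_post y"
          using x True safe_inv_next by metis
        moreover have "\<not> holds L (Goal G) x"
          using x True safe_inv_not_goal goal_post by metis
        \<comment> \<open>As \<open>x\<close> is no goal, its successor stays in
          \<open>\<phi>\<close>, where \<open>?P\<close> asks for the invariant of the post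
          game.\<close>
        ultimately show ?thesis
          using stay(3)[OF m(1) True] m by simp
      next
        case False
        then have "safe_inv G_pre SS_pre y \<and> \<not> holds2 L F' x y"
          using pre_step(1)[of x SS y] S x y by simp
        \<comment> \<open>If \<open>y\<close> satisfies \<open>\<phi>\<close>, the move crosses
          outside \<open>F\<close> and enters the invariant of the post game; otherwise that of the
          pre game persists.\<close>
        then show ?thesis
          using m False stay(1) safe_inv_post_entry by simp
      qed
    next
      fix x y
      assume x: "?P x" and y: "move G x y"
      show "\<exists>y. strat_move G SAFE SS x y"
      proof (cases "holds L \<phi> x")
        case True
        then have "move G_post x y"
          using y move_post_game[OF sp] by blast
        then obtain z where "strat_move G_post SAFE SS_post x z"
          using x True safe_inv_ex by metis
        then have "strat_move G SAFE SS x z"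
          using x True S move_states[of G x z] by (auto simp: strat_move_def move_post_game[OF sp] simp del: owned.simps)
        then show ?thesis
      by blast
      next
        case False
        then show ?thesis
          using pre_step(2)[of x SS y] S x y by simp
      qed
    qed
  qed
qed

lemma correct_recurse: "correct G ((Init G \<^bold>\<and> Goal G) \<^bold>\<or> R_pre) SR SS"
  unfolding correct_def
proof (intro conjI ballI impI)
  show "symbolic_strategy L G SR" "symbolic_strategy L G SS"
    by (rule symbolic_strategy_SR symbolic_strategy_SS)+
  show "reach_attr G SR s" if "s \<in> states L" "holds L ((Init G \<^bold>\<and> Goal G) \<^bold>\<or> R_pre) s" for s
    using that correctD(3)[OF pre] reach_attr_pre by (auto simp: holds_simps intro: reach_attr.goal)
  show "safe_inv G SS s" if "s \<in> states L" "holds L (Init G) s \<and> \<not> holds L ((Init G \<^bold>\<and> Goal G) \<^bold>\<or> R_pre) s" for s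
    using that by (intro safe_inv_SS) (auto simp: holds_simps holds_I)
  show "reach_attr G SR x" if "x \<in> owned L REACH" "y \<in> states L" "holds2 L SR x y" for x y
    using that by (rule reach_attr_SR)
qed

end

end

end

section \<open>Induction on the run of the procedure\<close>

lemma returns_correct:
  assumes itp: "interpolation L itp"
    and "returns L itp G R SR SS" "reachability_game L G"
  shows "correct G R SR SS"
proof -
  \<comment> \<open>Stated for arbitrary games, since the induction applies it to every game that
    occurs in the run.\<close>
  have interpolant: "state_pred L (itp I (Goal G))"
      "\<And>x. \<lbrakk>x \<in> states L; holds L (Goal G) x\<rbrakk> \<Longrightarrow> holds L (itp I (Goal G)) x"
      "\<And>x. \<lbrakk>x \<in> states L; holds L I x\<rbrakk> \<Longrightarrow> \<not> holds L (itp I (Goal G)) x"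
    if "reachability_game L G" "I = Init G \<^bold>\<and> \<^bold>\<not> Goal G" for G I
  proof -
    have "state_pred L (Goal G)"
      using that by (simp add: reachability_game_def)
    moreover have "False" if "x \<in> states L" "y \<in> states L" "holds2 L I x y" "holds2 L (Goal G) x y" for x y
      using that \<open>I = _\<close> by (simp add: holds2_simps)
    ultimately show "state_pred L (itp I (Goal G))"
      "\<And>x. \<lbrakk>x \<in> states L; holds L (Goal G) x\<rbrakk> \<Longrightarrow> holds L (itp I (Goal G)) x"
      "\<And>x. \<lbrakk>x \<in> states L; holds L I x\<rbrakk> \<Longrightarrow> \<not> holds L (itp I (Goal G)) x"
      using interpolant_of_conflict[OF itp, of "Goal G" I] by blast+
  qed
  show ?thesis
    using assms(2,3)
  proof (induction rule: returns.induct)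
    case (all_goal R G I)
    have "correct G (Init G \<^bold>\<and> Goal G) \<^bold>\<bottom> \<^bold>\<bottom>"
    proof (rule correct_no_reach_strategy)
      show "symbolic_strategy L G \<^bold>\<bottom>"
        by (auto simp: symbolic_strategy_iff holds2_simps)
      show "safe_inv G \<^bold>\<bottom> s" if "s \<in> states L" "holds L (Init G) s" "\<not> holds L (Goal G) s" for s
        using that all_goal by (auto simp: satisfiable_iff holds2_simps holds_def)
    qed
    then show ?case
      using all_goal by simp
  next
    case (no_enforceable_subgoal R G I \<phi> C)
    note itp_facts = interpolant[OF no_enforceable_subgoal.prems no_enforceable_subgoal.hyps(2)]
    show ?case
      using correct_no_enforceable_subgoal[OF no_enforceable_subgoal.prems no_enforceable_subgoal.hyps(2) itp_facts]
        no_enforceable_subgoal by simp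
  next
    case (no_winning_subgoal R G I \<phi> C R_post SR_post SS_post F)
    note itp_facts = interpolant[OF no_winning_subgoal.prems no_winning_subgoal.hyps(2)]
    have "correct (post_game L \<phi> C G) R_post SR_post SS_post"
      using no_winning_subgoal.IH no_winning_subgoal.prems reachability_game_post_game by blast
    then show ?case
      using correct_no_winning_subgoal[OF no_winning_subgoal.prems no_winning_subgoal.hyps(2) itp_facts]
        no_winning_subgoal.hyps by simp
  next
    case (recurse R G I \<phi> C R_post SR_post SS_post F F' \<phi>' R_pre SR_pre SS_pre)
    note itp_facts = interpolant[OF recurse.prems recurse.hyps(2)]
    have post: "correct (post_game L (itp I (Goal G)) (Instantiate L (itp I (Goal G)) G) G) R_post SR_post SS_post"
      using recurse.IH(1) recurse.prems reachability_game_post_game recurse.hyps by simp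
    have "state_pred L I"
      using recurse.prems recurse.hyps(2)
      by (simp add: reachability_game_def state_pred_conj state_pred_neg)
    then have pre: "correct (pre_game L I F' G) R_pre SR_pre SS_pre"
      using recurse.IH(2) recurse.prems reachability_game_pre_game by blast
    show ?case
      using correct_recurse[OF recurse.prems recurse.hyps(2) itp_facts post _ _ pre] recurse.hyps by simp
  qed
qed

end

theorem theorem1:
  fixes L :: "('f, 'v::finite, 'd) logic_sig"
    and itp :: "'f \<Rightarrow> 'f \<Rightarrow> 'f"
    and G :: "'f game"
    and R SR SS :: 'f
  assumes "reach_logic L"
    and "interpolation L itp"
    and "reachability_game L G"
    and "returns L itp G R SR SS"
  shows "(\<forall>s \<in> states L. holds L (Init G) s \<longrightarrow> (holds L R s \<longleftrightarrow> wins_from L G REACH s)) \<and>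
    (symbolic_strategy L G SR \<and>
      (\<forall>s \<in> states L. holds L R s \<longrightarrow> symbolic_winning L G REACH SR s)) \<and>
    (symbolic_strategy L G SS \<and>
      (\<forall>s \<in> states L. holds L (Init G) s \<and> \<not> holds L R s \<longrightarrow> symbolic_winning L G SAFE SS s))"
proof -
  interpret reach_logic L
    by (rule assms(1))
  have correct: "correct G R SR SS"
    using assms(2,4,3) by (rule returns_correct)
  \<comment> \<open>The attractor gives one direction of the characterization of \<open>R\<close>;
    for initial states outside \<open>R\<close>, the invariant excludes a win of REACH.\<close>
  show ?thesis
    using correctD[OF correct] reach_attr_symbolic_winning[OF assms(3)] reach_attr_wins_from[OF assms(3)]
      safe_inv_symbolic_winning[OF assms(3)] safe_inv_not_wins_from[OF assms(3)]
    by blast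
qed

end
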